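(* For every integer $n\ge1$, the number of $C$-invariant Heisenberg characters of $\mathbf{U}_{n+1}(\mathbb{F}_q)$ is $\widetilde{\mathcal{I}}_n(q-1)$.
   Context: $\mathbf{U}_m(\mathbb{F}_q)$ is the group of $m\times m$ unitriangular matrices over $\mathbb F_q$. A Heisenberg character of a group $G$ is an irreducible character whose kernel contains $[G,[G,G]]$. $\sigma:\mathbf U_m(\mathbb F_q)\to\mathbb F_q^+$ is $\sigma(g)=\sum_{i=1}^{m-1}g_{i,i+1}$, $C=\{\vartheta\circ\sigma:\vartheta\in\mathrm{Hom}(\mathbb F_q^+,\mathbb C^\times)\}$, and a character $\chi$ is $C$-invariant if $\psi\chi=\chi$ for all $\psi\in C$. $D''(a,b)$ is the number of lattice paths from $(0,0)$ to $(a,b)$ with steps in $\{(2,1),(1,2),(0,1)\}$; $\mathcal I_{m+1}(x)=\sum_{k=0}^mD''(m-k,k)x^k$ for $m\ge0$ and $\mathcal I_m(x)=0$ for $m\le0$; $\widetilde{\mathcal I}_n(x)=x\mathcal I_{n-1}(x)+x\mathcal I_{n-2}(x)$. *)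

theory Defs
  imports
    Complex_Main
    "HOL-Library.FuncSet"
    "HOL-Library.Cardinality"
    "HOL-Library.Product_Plus"
    "HOL-Algebra.Generated_Groups"
    "HOL-Computational_Algebra.Polynomial"
    "Jordan_Normal_Form.VS_Connect"
begin

section \<open>Complex characters of groups\<close>

definition GL :: "nat \<Rightarrow> complex mat monoid" where
  "GL d = units_of (ring_mat TYPE(complex) d ())"

definition mat_trace :: "'a::comm_monoid_add mat \<Rightarrow> 'a" where
  "mat_trace A = (\<Sum>i<dim_row A. A $$ (i, i))"

definition irreducible_rep ::
    "('g, 'b) monoid_scheme \<Rightarrow> nat \<Rightarrow> ('g \<Rightarrow> complex mat) \<Rightarrow> bool" where
  "irreducible_rep G d \<rho> \<longleftrightarrow>
     \<rho> \<in> hom G (GL d) \<and> d > 0 \<and>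
     (\<forall>W. VectorSpace.subspace class_ring W (module_vec TYPE(complex) d) \<longrightarrow>
          (\<forall>g\<in>carrier G. \<forall>w\<in>W. \<rho> g *\<^sub>v w \<in> W) \<longrightarrow>
          W = {0\<^sub>v d} \<or> W = carrier_vec d)"

text \<open>Functions on a group are represented by functions that are \<^const>\<open>undefined\<close> off the
  carrier, so that equality of functions is equality on the group and characters can be counted.\<close>

definition irreducible_characters :: "('g, 'b) monoid_scheme \<Rightarrow> ('g \<Rightarrow> complex) set" where
  "irreducible_characters G =
     {\<lambda>g\<in>carrier G. mat_trace (\<rho> g) | d \<rho>. irreducible_rep G d \<rho>}"

definition character_kernel :: "('g, 'b) monoid_scheme \<Rightarrow> ('g \<Rightarrow> complex) \<Rightarrow> 'g set" where
  "character_kernel G \<chi> = {g \<in> carrier G. \<chi> g = \<chi> \<one>\<^bsub>G\<^esub>}"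

definition commutator_subgroup ::
    "('g, 'b) monoid_scheme \<Rightarrow> 'g set \<Rightarrow> 'g set \<Rightarrow> 'g set" where
  "commutator_subgroup G H K =
     generate G (\<Union>h\<in>H. \<Union>k\<in>K. {h \<otimes>\<^bsub>G\<^esub> k \<otimes>\<^bsub>G\<^esub> inv\<^bsub>G\<^esub> h \<otimes>\<^bsub>G\<^esub> inv\<^bsub>G\<^esub> k})"

definition Heisenberg_characters :: "('g, 'b) monoid_scheme \<Rightarrow> ('g \<Rightarrow> complex) set" where
  "Heisenberg_characters G =
     {\<chi> \<in> irreducible_characters G.
        commutator_subgroup G (carrier G) (derived G (carrier G)) \<subseteq> character_kernel G \<chi>}"

definition invariant_under ::
    "('g, 'b) monoid_scheme \<Rightarrow> ('g \<Rightarrow> complex) set \<Rightarrow> ('g \<Rightarrow> complex) \<Rightarrow> bool" where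
  "invariant_under G C \<chi> \<longleftrightarrow> (\<forall>\<psi>\<in>C. (\<lambda>g\<in>carrier G. \<psi> g * \<chi> g) = \<chi>)"

section \<open>The unitriangular group\<close>

definition unitriangular_group :: "'a::field itself \<Rightarrow> nat \<Rightarrow> 'a mat monoid" where
  "unitriangular_group ty m =
     \<lparr>carrier = {A \<in> carrier_mat m m. upper_triangular A \<and> (\<forall>i<m. A $$ (i, i) = 1)},
      monoid.mult = (*), one = 1\<^sub>m m\<rparr>"

text \<open>Matrix indices start at 0.\<close>

definition superdiagonal_sum :: "nat \<Rightarrow> 'a::field mat \<Rightarrow> 'a" where
  "superdiagonal_sum m A = (\<Sum>i<m - 1. A $$ (i, i + 1))"

definition additive_characters :: "'a::field itself \<Rightarrow> ('a \<Rightarrow> complex) set" where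
  "additive_characters ty =
     hom (add_monoid (class_ring :: 'a ring)) (units_of (class_ring :: complex ring))"

definition superdiagonal_characters :: "'a::field itself \<Rightarrow> nat \<Rightarrow> ('a mat \<Rightarrow> complex) set" where
  "superdiagonal_characters ty m =
     {restrict (\<theta> \<circ> superdiagonal_sum m) (carrier (unitriangular_group ty m)) | \<theta>.
        \<theta> \<in> additive_characters ty}"

section \<open>Lattice paths and the counting polynomials\<close>

text \<open>A path from the origin is given by its list of steps; addition of steps is componentwise.\<close>

definition lattice_paths :: "nat \<Rightarrow> nat \<Rightarrow> (nat \<times> nat) list set" where
  "lattice_paths a b =
     {steps. set steps \<subseteq> {(2, 1), (1, 2), (0, 1)} \<and> sum_list steps = (a, b)}"

definition I_poly :: "int \<Rightarrow> int poly" where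
  "I_poly j =
     (if j \<le> 0 then 0
      else let m = nat (j - 1)
           in \<Sum>k\<le>m. Polynomial.monom (int (card (lattice_paths (m - k) k))) k)"

definition I_tilde_poly :: "int \<Rightarrow> int poly" where
  "I_tilde_poly n = [:0, 1:] * I_poly (n - 1) + [:0, 1:] * I_poly (n - 2)"

end

theory Submission
  imports Defs "HOL-Number_Theory.Cong" "Jordan_Normal_Form.Spectral_Radius"
begin

text \<open>A Heisenberg character of the unitriangular group only sees the first superdiagonal \<open>a\<close> and the
  second superdiagonal \<open>b\<close>. On the matrices with \<open>a = 0\<close> it is a multiple of \<open>\<theta> (c \<bullet> b)\<close> for a fixed
  nontrivial additive character \<open>\<theta>\<close> and some vector \<open>c\<close>. It vanishes unless \<open>a\<close> lies in the radical
  of the alternating form \<open>\<Sum> c\<^sub>i (x\<^sub>i y\<^sub>i\<^sub>+\<^sub>1 - y\<^sub>i x\<^sub>i\<^sub>+\<^sub>1)\<close>, and over each \<open>c\<close> there are as many characters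
  as elements of the radical. Such a character is invariant iff the all-ones functional vanishes on
  the radical, that is, iff it is represented by some vector \<open>v\<close> through the form; the number of such
  \<open>v\<close> is then again the size of the radical. Hence the invariant characters are equinumerous with
  the pairs \<open>(c, v)\<close> solving this system of bilinear equations. These are counted by a transfer
  recursion along the superdiagonal, which is matched with the recursion for the lattice paths
  obtained by removing the first step.\<close>

section \<open>Matrix representations\<close>

text \<open>Modulo \<open>[G,[G,G]]\<close> the group is a central extension of the vectors
  \<open>a\<close> by the vectors \<open>b\<close>, and its cocycle, paired with \<open>c\<close>,
  is the bilinear form \<open>path_form\<close>. In characteristic 2 this cocycle cannot be traded
  for half of its alternating form, so nothing general ensures that the scalars over the radical
  have the shape \<open>\<theta> (y \<bullet> a)\<close> for the evident lifts of \<open>a\<close>.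
  What rescues the argument is special to a path: the cocycle itself, not only its alternating form,
  vanishes on the radical (\<open>path_radical_isotropic\<close>). No irreducible representation is
  written down. Among all representations with the right central scalars one of least dimension is
  irreducible; its trace is then forced by Schur's lemma, conjugation and the fact that an
  irreducible character has norm 1, and twists by linear characters reach the remaining ones.
  Likewise, duality between image and radical comes from sums of values of \<open>\<theta>\<close>
  and not from dimension formulas.\<close>

lemma mult_mat_entry:
  assumes "A \<in> carrier_mat nr n" "B \<in> carrier_mat n nc" "i < nr" "j < nc"
  shows "(A * B) $$ (i, j) = (\<Sum>p<n. A $$ (i, p) * B $$ (p, j))"
  using assms by (auto simp: scalar_prod_def lessThan_atLeast0 intro!: sum.cong)

lemma mult_mat_vec_entry:
  assumes "A \<in> carrier_mat nr n" "v \<in> carrier_vec n" "i < nr"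
  shows "(A *\<^sub>v v) $ i = (\<Sum>p<n. A $$ (i, p) * v $ p)"
  using assms by (auto simp: scalar_prod_def lessThan_atLeast0 intro!: sum.cong)

lemma mat_eq_if_mult_vec_eq:
  fixes A B :: "'a::comm_ring_1 mat"
  assumes "A \<in> carrier_mat nr nc" "B \<in> carrier_mat nr nc"
    and eq: "\<And>v. v \<in> carrier_vec nc \<Longrightarrow> A *\<^sub>v v = B *\<^sub>v v"
  shows "A = B"
proof (rule eq_matI)
  fix i j assume ij: "i < dim_row B" "j < dim_col B"
  have "(A *\<^sub>v unit_vec nc j) $ i = (B *\<^sub>v unit_vec nc j) $ i"
    using eq[of "unit_vec nc j"] by simp
  thus "A $$ (i, j) = B $$ (i, j)"
    using assms(1,2) ij by (simp add: scalar_prod_right_unit[of _ nc])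
qed (use assms in auto)

lemma mat_trace_carrier: "A \<in> carrier_mat d d \<Longrightarrow> mat_trace A = (\<Sum>i<d. A $$ (i, i))"
  by (auto simp: mat_trace_def)

lemma subspace_module_vec_iff:
  "VectorSpace.subspace class_ring W (module_vec TYPE('a::field) d) \<longleftrightarrow>
     W \<subseteq> carrier_vec d \<and> 0\<^sub>v d \<in> W \<and> (\<forall>v\<in>W. \<forall>w\<in>W. v + w \<in> W) \<and> (\<forall>c. \<forall>v\<in>W. c \<cdot>\<^sub>v v \<in> W)"
  unfolding VectorSpace.subspace_def submodule_def
  using vec_vs[of d] vec_module[of d] by (auto simp: module_vec_simps)

section \<open>Schur's lemma, averaging over a finite group, and twists\<close>

context group
begin

text \<open>Requiring \<open>\<rho> \<one>\<close> to be the identity matrix makes invertibility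
  automatic: \<open>\<rho> (inv g)\<close> is the inverse of \<open>\<rho> g\<close>.\<close>

lemma hom_GL_iff:
  "\<rho> \<in> hom G (GL d) \<longleftrightarrow>
     (\<forall>g\<in>carrier G. \<rho> g \<in> carrier_mat d d) \<and> \<rho> \<one> = 1\<^sub>m d \<and>
     (\<forall>g\<in>carrier G. \<forall>h\<in>carrier G. \<rho> (g \<otimes> h) = \<rho> g * \<rho> h)"
proof
  interpret R: ring "ring_mat TYPE(complex) d ()" by (rule ring_mat)
  have grp: "group (GL d)" unfolding GL_def by (rule R.units_group)
  assume \<rho>: "\<rho> \<in> hom G (GL d)"
  have "\<rho> g \<in> carrier_mat d d" if "g \<in> carrier G" for g
    using hom_carrier[OF \<rho>] that
    by (auto simp: GL_def units_of_carrier Units_def ring_mat_simps)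
  moreover have "\<rho> \<one> = 1\<^sub>m d"
    using hom_one[OF \<rho> group_axioms grp] by (simp add: GL_def units_of_one ring_mat_simps)
  moreover have "\<rho> (g \<otimes> h) = \<rho> g * \<rho> h" if "g \<in> carrier G" "h \<in> carrier G" for g h
    using hom_mult[OF \<rho> that] by (simp add: GL_def units_of_mult ring_mat_simps)
  ultimately show "(\<forall>g\<in>carrier G. \<rho> g \<in> carrier_mat d d) \<and> \<rho> \<one> = 1\<^sub>m d \<and>
     (\<forall>g\<in>carrier G. \<forall>h\<in>carrier G. \<rho> (g \<otimes> h) = \<rho> g * \<rho> h)" by blast
next
  assume *: "(\<forall>g\<in>carrier G. \<rho> g \<in> carrier_mat d d) \<and> \<rho> \<one> = 1\<^sub>m d \<and>
     (\<forall>g\<in>carrier G. \<forall>h\<in>carrier G. \<rho> (g \<otimes> h) = \<rho> g * \<rho> h)"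
  show "\<rho> \<in> hom G (GL d)"
  proof (rule homI)
    fix g assume g: "g \<in> carrier G"
    have "\<rho> (inv g) * \<rho> g = 1\<^sub>m d" "\<rho> g * \<rho> (inv g) = 1\<^sub>m d"
      using * g by (metis inv_closed l_inv r_inv)+
    thus "\<rho> g \<in> carrier (GL d)" using * g inv_closed[OF g]
      unfolding GL_def units_of_carrier Units_def ring_mat_simps by auto
  qed (use * in \<open>simp add: GL_def units_of_mult ring_mat_simps\<close>)
qed

lemma irreducible_repD:
  assumes "irreducible_rep G d \<rho>"
  shows "d > 0" "\<rho> \<one> = 1\<^sub>m d"
    and "\<And>g. g \<in> carrier G \<Longrightarrow> \<rho> g \<in> carrier_mat d d"
    and "\<And>g h. g \<in> carrier G \<Longrightarrow> h \<in> carrier G \<Longrightarrow> \<rho> (g \<otimes> h) = \<rho> g * \<rho> h"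
  using assms unfolding irreducible_rep_def hom_GL_iff by auto

lemma irreducible_repD_entry:
  assumes "irreducible_rep G d \<rho>" "g \<in> carrier G" "h \<in> carrier G" "i < d" "j < d"
  shows "(\<Sum>p<d. \<rho> g $$ (i, p) * \<rho> h $$ (p, j)) = \<rho> (g \<otimes> h) $$ (i, j)"
  using assms irreducible_repD[OF assms(1)] by (simp add: mult_mat_entry[of _ d d _ d])

text \<open>Over the complex numbers \<open>M\<close> has an eigenvalue, and commutation makes its
  eigenspace invariant; being nonzero, it is the whole space.\<close>

theorem schur_lemma:
  assumes irr: "irreducible_rep G d \<rho>" and M: "M \<in> carrier_mat d d"
    and comm: "\<And>g. g \<in> carrier G \<Longrightarrow> \<rho> g * M = M * \<rho> g"
  obtains k where "M = k \<cdot>\<^sub>m 1\<^sub>m d"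
proof -
  note D = irreducible_repD[OF irr]
  obtain k v where v: "v \<in> carrier_vec d" "v \<noteq> 0\<^sub>v d" "M *\<^sub>v v = k \<cdot>\<^sub>v v"
    using spectrum_non_empty[OF M D(1)] M
    unfolding spectrum_def eigenvalue_def eigenvector_def by auto
  define W where "W = {w \<in> carrier_vec d. M *\<^sub>v w = k \<cdot>\<^sub>v w}"
  have "VectorSpace.subspace class_ring W (module_vec TYPE(complex) d)"
    unfolding subspace_module_vec_iff W_def using M
    by (auto simp: mult_add_distrib_mat_vec smult_add_distrib_vec mult_mat_vec smult_smult_assoc mult.commute)
  moreover have "\<rho> g *\<^sub>v w \<in> W" if g: "g \<in> carrier G" and w: "w \<in> W" for g w
  proof -
    have w': "w \<in> carrier_vec d" "M *\<^sub>v w = k \<cdot>\<^sub>v w" using w by (auto simp: W_def)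
    have "M *\<^sub>v (\<rho> g *\<^sub>v w) = (M * \<rho> g) *\<^sub>v w"
      using assoc_mult_mat_vec[OF M D(3)[OF g] w'(1)] by simp
    also have "\<dots> = \<rho> g *\<^sub>v (M *\<^sub>v w)"
      unfolding comm[OF g, symmetric] by (rule assoc_mult_mat_vec[OF D(3)[OF g] M w'(1)])
    also have "\<dots> = k \<cdot>\<^sub>v (\<rho> g *\<^sub>v w)"
      using w' D(3)[OF g] by (simp add: mult_mat_vec)
    finally show ?thesis using D(3)[OF g] w'(1) by (simp add: W_def)
  qed
  ultimately have "W = {0\<^sub>v d} \<or> W = carrier_vec d"
    using irr unfolding irreducible_rep_def by blast
  moreover have "v \<in> W" using v by (simp add: W_def)
  ultimately have W: "W = carrier_vec d" using v by auto
  have "M = k \<cdot>\<^sub>m 1\<^sub>m d"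
  proof (rule mat_eq_if_mult_vec_eq)
    fix w :: "complex vec" assume w: "w \<in> carrier_vec d"
    hence "M *\<^sub>v w = k \<cdot>\<^sub>v w" using W by (auto simp: W_def)
    also have "\<dots> = (k \<cdot>\<^sub>m 1\<^sub>m d) *\<^sub>v w"
      using w by (intro eq_vecI) auto
    finally show "M *\<^sub>v w = (k \<cdot>\<^sub>m 1\<^sub>m d) *\<^sub>v w" .
  qed (use M in auto)
  thus ?thesis by (rule that)
qed

lemma mat_trace_smult_one [simp]: "mat_trace (k \<cdot>\<^sub>m 1\<^sub>m d) = of_nat d * (k::complex)"
  by (simp add: mat_trace_def)

lemma irreducible_rep_trace_one:
  assumes "irreducible_rep G d \<rho>"
  shows "mat_trace (\<rho> \<one>) = of_nat d"
  unfolding irreducible_repD(2)[OF assms] mat_trace_def by simp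

text \<open>The sum over \<^term>\<open>N\<close> is central, hence scalar, and its trace forces the scalar to be
  \<^term>\<open>card N\<close>; since it absorbs each \<^term>\<open>\<rho> z\<close>, no eigenvalue argument is needed.\<close>

lemma irreducible_rep_trivial_on_kernel:
  assumes irr: "irreducible_rep G d \<rho>" and N: "subgroup N G" "finite N"
    and norm: "\<And>g z. g \<in> carrier G \<Longrightarrow> z \<in> N \<Longrightarrow> g \<otimes> z \<otimes> inv g \<in> N"
    and tr: "\<And>z. z \<in> N \<Longrightarrow> mat_trace (\<rho> z) = mat_trace (\<rho> \<one>)"
    and z: "z \<in> N"
  shows "\<rho> z = 1\<^sub>m d"
proof -
  note D = irreducible_repD[OF irr] and E = irreducible_repD_entry[OF irr]
  have NG: "z \<in> carrier G" if "z \<in> N" for z using subgroup.mem_carrier[OF N(1) that] .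
  define P where "P = mat d d (\<lambda>(k, l). \<Sum>z\<in>N. \<rho> z $$ (k, l))"
  have P: "P \<in> carrier_mat d d" by (simp add: P_def)
  have left: "(\<rho> g * P) $$ (i, j) = (\<Sum>z\<in>N. \<rho> (g \<otimes> z) $$ (i, j))"
    if "g \<in> carrier G" "i < d" "j < d" for g i j
  proof -
    have "(\<rho> g * P) $$ (i, j) = (\<Sum>p<d. \<Sum>z\<in>N. \<rho> g $$ (i, p) * \<rho> z $$ (p, j))"
      using that D(3) by (simp add: mult_mat_entry[of _ d d _ d] P sum_distrib_left) (simp add: P_def sum_distrib_left)
    also have "\<dots> = (\<Sum>z\<in>N. \<rho> (g \<otimes> z) $$ (i, j))"
      by (subst sum.swap) (use that NG in \<open>simp add: E\<close>)
    finally show ?thesis .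
  qed
  have right: "(P * \<rho> g) $$ (i, j) = (\<Sum>z\<in>N. \<rho> (z \<otimes> g) $$ (i, j))"
    if "g \<in> carrier G" "i < d" "j < d" for g i j
  proof -
    have "(P * \<rho> g) $$ (i, j) = (\<Sum>p<d. \<Sum>z\<in>N. \<rho> z $$ (i, p) * \<rho> g $$ (p, j))"
      using that D(3) by (simp add: mult_mat_entry[of _ d d _ d] P) (simp add: P_def sum_distrib_right)
    also have "\<dots> = (\<Sum>z\<in>N. \<rho> (z \<otimes> g) $$ (i, j))"
      by (subst sum.swap) (use that NG in \<open>simp add: E\<close>)
    finally show ?thesis .
  qed
  have "\<rho> g * P = P * \<rho> g" if g: "g \<in> carrier G" for g
  proof (rule eq_matI)
    fix i j assume "i < dim_row (P * \<rho> g)" "j < dim_col (P * \<rho> g)"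
    hence ij: "i < d" "j < d" using P D(3)[OF g] by auto
    have "(\<Sum>z\<in>N. \<rho> (g \<otimes> z) $$ (i, j)) = (\<Sum>z\<in>N. \<rho> (z \<otimes> g) $$ (i, j))"
      by (rule sum.reindex_bij_witness[where j = "\<lambda>z. g \<otimes> z \<otimes> inv g" and i = "\<lambda>z. inv g \<otimes> z \<otimes> g"])
        (use g NG norm norm[of "inv g"] in \<open>auto simp: m_assoc inv_solve_left'[symmetric] l_inv_ex\<close>,
         (simp add: m_assoc[symmetric])+)
    thus "(\<rho> g * P) $$ (i, j) = (P * \<rho> g) $$ (i, j)" using g ij by (simp add: left right)
  qed (use P D(3)[OF g] in auto)
  then obtain k where k: "P = k \<cdot>\<^sub>m 1\<^sub>m d" by (rule schur_lemma[OF irr P])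
  have "of_nat d * k = mat_trace P" by (simp add: k)
  also have "\<dots> = (\<Sum>z\<in>N. mat_trace (\<rho> z))"
    using P D(3)[OF NG] by (simp add: mat_trace_carrier[of _ d]) (simp add: P_def sum.swap[of _ N])
  also have "\<dots> = of_nat d * of_nat (card N)"
    using tr by (simp add: irreducible_rep_trace_one[OF irr])
  finally have k': "k = of_nat (card N)" using D(1) by simp
  have "(\<rho> z * P) = P"
  proof (rule eq_matI)
    fix i j assume "i < dim_row P" "j < dim_col P"
    hence ij: "i < d" "j < d" using P by auto
    have "(\<Sum>w\<in>N. \<rho> (z \<otimes> w) $$ (i, j)) = (\<Sum>w\<in>N. \<rho> w $$ (i, j))"
      by (rule sum.reindex_bij_witness[where j = "\<lambda>w. z \<otimes> w" and i = "\<lambda>w. inv z \<otimes> w"])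
        (use z NG N subgroup.m_closed[OF N(1)] subgroup.m_inv_closed[OF N(1)] in \<open>auto simp: m_assoc[symmetric]\<close>)
    thus "(\<rho> z * P) $$ (i, j) = P $$ (i, j)" using z NG ij by (simp add: left) (simp add: P_def)
  qed (use P D(3)[OF NG[OF z]] in auto)
  moreover have "\<rho> z * P = k \<cdot>\<^sub>m \<rho> z" using D(3)[OF NG[OF z]] by (simp add: k mult_smult_distrib[of _ d d "1\<^sub>m d" d])
  ultimately have "k \<cdot>\<^sub>m \<rho> z = k \<cdot>\<^sub>m 1\<^sub>m d" by (simp add: k)
  moreover have "k \<noteq> 0" using k' z N(2) by auto
  ultimately show ?thesis using D(3)[OF NG[OF z]]
    by (auto simp: mat_eq_iff)
qed

text \<open>Orthogonality of a character with itself. Writing \<open>inv g\<close> in place of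
  complex conjugation avoids unitary representations. The relation later determines the
  degree.\<close>

theorem irreducible_rep_norm:
  assumes irr: "irreducible_rep G d \<rho>" and fin: "finite (carrier G)"
  shows "(\<Sum>g\<in>carrier G. mat_trace (\<rho> g) * mat_trace (\<rho> (inv g))) = of_nat (card (carrier G))"
proof -
  note D = irreducible_repD[OF irr] and E = irreducible_repD_entry[OF irr]
  have main: "(\<Sum>g\<in>carrier G. \<rho> g $$ (i, i) * \<rho> (inv g) $$ (j, j)) =
      (if i = j then of_nat (card (carrier G)) / of_nat d else 0)"
    if i: "i < d" and j: "j < d" for i j
  proof -
    \<comment> \<open>\<open>M\<close> sums the conjugates of the matrix unit at
      \<open>(i, j)\<close> by all \<open>\<rho> g\<close>, so it commutes with the representation.
      Its entry at \<open>(i, j)\<close> is the sum in question, and its trace evaluates the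
      scalar.\<close>
    define M where "M = mat d d (\<lambda>(k, l). \<Sum>g\<in>carrier G. \<rho> g $$ (k, i) * \<rho> (inv g) $$ (j, l))"
    have M: "M \<in> carrier_mat d d" by (simp add: M_def)
    have "\<rho> h * M = M * \<rho> h" if h: "h \<in> carrier G" for h
    proof (rule eq_matI)
      fix k l assume "k < dim_row (M * \<rho> h)" "l < dim_col (M * \<rho> h)"
      hence kl: "k < d" "l < d" using M D(3)[OF h] by auto
      have "(\<rho> h * M) $$ (k, l) =
          (\<Sum>p<d. \<Sum>g\<in>carrier G. \<rho> h $$ (k, p) * \<rho> g $$ (p, i) * \<rho> (inv g) $$ (j, l))"
        using kl D(3)[OF h] by (simp add: mult_mat_entry[of _ d d _ d] M) (simp add: M_def sum_distrib_left mult.assoc)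
      also have "\<dots> = (\<Sum>g\<in>carrier G. \<rho> (h \<otimes> g) $$ (k, i) * \<rho> (inv g) $$ (j, l))"
        by (subst sum.swap) (use h kl i in \<open>simp add: E flip: sum_distrib_right\<close>)
      also have "\<dots> = (\<Sum>g\<in>carrier G. \<rho> g $$ (k, i) * \<rho> (inv g \<otimes> h) $$ (j, l))"
        by (rule sum.reindex_bij_witness[where j = "\<lambda>w. h \<otimes> w" and i = "\<lambda>w. inv h \<otimes> w"])
          (use h in \<open>auto simp: m_assoc[symmetric] inv_mult_group\<close>, simp add: m_assoc)
      also have "\<dots> = (\<Sum>p<d. \<Sum>g\<in>carrier G. \<rho> g $$ (k, i) * (\<rho> (inv g) $$ (j, p) * \<rho> h $$ (p, l)))"
        by (subst sum.swap) (use h kl j in \<open>simp add: E flip: sum_distrib_left\<close>)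
      also have "\<dots> = (M * \<rho> h) $$ (k, l)"
        using kl D(3)[OF h] by (simp add: mult_mat_entry[of _ d d _ d] M) (simp add: M_def sum_distrib_right mult.assoc)
      finally show "(\<rho> h * M) $$ (k, l) = (M * \<rho> h) $$ (k, l)" .
    qed (use M D(3)[OF h] in auto)
    then obtain c where c: "M = c \<cdot>\<^sub>m 1\<^sub>m d" by (rule schur_lemma[OF irr M])
    have "of_nat d * c = mat_trace M" by (simp add: c)
    also have "\<dots> = (\<Sum>k<d. \<Sum>g\<in>carrier G. \<rho> (inv g) $$ (j, k) * \<rho> g $$ (k, i))"
      by (simp add: mat_trace_def M_def mult.commute)
    also have "\<dots> = (\<Sum>g\<in>carrier G. \<rho> \<one> $$ (j, i))"
      by (subst sum.swap) (use i j in \<open>simp add: E\<close>)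
    also have "\<dots> = (if i = j then of_nat (card (carrier G)) else 0)"
      using i j by (simp add: D(2))
    finally have c': "c = (if i = j then of_nat (card (carrier G)) / of_nat d else 0)"
      using D(1) by (auto simp: field_simps split: if_splits)
    have "(\<Sum>g\<in>carrier G. \<rho> g $$ (i, i) * \<rho> (inv g) $$ (j, j)) = M $$ (i, j)"
      using i j by (simp add: M_def)
    also have "\<dots> = (if i = j then c else 0)" using i j by (simp add: c)
    finally show ?thesis by (simp add: c')
  qed
  have "(\<Sum>g\<in>carrier G. mat_trace (\<rho> g) * mat_trace (\<rho> (inv g))) =
      (\<Sum>g\<in>carrier G. \<Sum>i<d. \<Sum>j<d. \<rho> g $$ (i, i) * \<rho> (inv g) $$ (j, j))"
    using D(3) by (simp add: mat_trace_carrier[of _ d] sum_product)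
  also have "\<dots> = (\<Sum>i<d. \<Sum>j<d. \<Sum>g\<in>carrier G. \<rho> g $$ (i, i) * \<rho> (inv g) $$ (j, j))"
    by (subst sum.swap) (subst (2) sum.swap, rule refl)
  also have "\<dots> = (\<Sum>i<d. \<Sum>j<d. if i = j then of_nat (card (carrier G)) / of_nat d else 0)"
    by (intro sum.cong refl) (simp add: main)
  also have "\<dots> = of_nat (card (carrier G))" using D(1) by (simp add: sum.delta)
  finally show ?thesis .
qed

text \<open>A nonzero scalar factor does not change which subspaces are invariant. Twisting by
  characters of the first superdiagonal will move between characters with the same central
  part.\<close>

lemma irreducible_rep_twist:
  assumes irr: "irreducible_rep G d \<rho>"
    and mult: "\<And>g h. g \<in> carrier G \<Longrightarrow> h \<in> carrier G \<Longrightarrow> \<psi> (g \<otimes> h) = \<psi> g * \<psi> h"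
    and nz: "\<And>g. g \<in> carrier G \<Longrightarrow> \<psi> g \<noteq> (0::complex)"
  shows "irreducible_rep G d (\<lambda>g. \<psi> g \<cdot>\<^sub>m \<rho> g)"
proof -
  note D = irreducible_repD[OF irr]
  have one: "\<psi> \<one> = 1" using mult[of \<one> \<one>] nz[of \<one>] by simp
  have "W = {0\<^sub>v d} \<or> W = carrier_vec d"
    if W: "VectorSpace.subspace class_ring W (module_vec TYPE(complex) d)"
      and inv: "\<forall>g\<in>carrier G. \<forall>w\<in>W. (\<psi> g \<cdot>\<^sub>m \<rho> g) *\<^sub>v w \<in> W" for W
  proof -
    note W' = W[unfolded subspace_module_vec_iff]
    have "\<rho> g *\<^sub>v w \<in> W" if g: "g \<in> carrier G" and w: "w \<in> W" for g w
    proof -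
      have wd: "w \<in> carrier_vec d" using W' w by blast
      have "inverse (\<psi> g) \<cdot>\<^sub>v ((\<psi> g \<cdot>\<^sub>m \<rho> g) *\<^sub>v w) \<in> W" using W' inv g w by blast
      also have "inverse (\<psi> g) \<cdot>\<^sub>v ((\<psi> g \<cdot>\<^sub>m \<rho> g) *\<^sub>v w) = \<rho> g *\<^sub>v w"
        using D(3)[OF g] wd nz[OF g] by (intro eq_vecI) auto
      finally show ?thesis .
    qed
    thus ?thesis using irr W unfolding irreducible_rep_def by blast
  qed
  moreover have "(\<lambda>g. \<psi> g \<cdot>\<^sub>m \<rho> g) \<in> hom G (GL d)"
    unfolding hom_GL_iff
  proof (intro conjI ballI)
    show "\<psi> \<one> \<cdot>\<^sub>m \<rho> \<one> = 1\<^sub>m d" by (simp add: one D(2)) (intro eq_matI, auto)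
    fix g h assume gh: "g \<in> carrier G" "h \<in> carrier G"
    show "\<psi> (g \<otimes> h) \<cdot>\<^sub>m \<rho> (g \<otimes> h) = \<psi> g \<cdot>\<^sub>m \<rho> g * (\<psi> h \<cdot>\<^sub>m \<rho> h)"
      using gh D(3)[OF gh(1)] D(3)[OF gh(2)]
      by (simp add: mult D(4) mult_smult_distrib[of _ d d] mult_smult_assoc_mat[of _ d d]) 
         (intro eq_matI, auto simp: mult.commute)
  qed (use D(3) in auto)
  ultimately show ?thesis using D(1) unfolding irreducible_rep_def by blast
qed

end

section \<open>Subspaces as images of projections, and subrepresentations\<close>

text \<open>Padding both matrices with zeros to size \<open>k\<close> turns the left inverse into a
  two-sided one; but row \<open>d\<close> of the padded \<open>B\<close> is zero, so the product in
  the other order cannot be the identity.\<close>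

lemma left_invertible_mat_dim_le:
  fixes B :: "'a::field mat"
  assumes B: "B \<in> carrier_mat d k" and L: "L \<in> carrier_mat k d" and LB: "L * B = 1\<^sub>m k"
  shows "k \<le> d"
proof (rule ccontr)
  assume "\<not> k \<le> d"
  hence dk: "d < k" by simp
  define B' where "B' = mat k k (\<lambda>(i, j). if i < d then B $$ (i, j) else 0)"
  define L' where "L' = mat k k (\<lambda>(i, j). if j < d then L $$ (i, j) else 0)"
  have B': "B' \<in> carrier_mat k k" and L': "L' \<in> carrier_mat k k" by (auto simp: B'_def L'_def)
  have "L' * B' = 1\<^sub>m k"
  proof (rule eq_matI)
    fix i j assume "i < dim_row (1\<^sub>m k)" "j < dim_col (1\<^sub>m k)"
    hence ij: "i < k" "j < k" by auto
    have "(L' * B') $$ (i, j) = (\<Sum>p<k. L' $$ (i, p) * B' $$ (p, j))"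
      using ij by (rule mult_mat_entry[OF L' B'])
    also have "\<dots> = (\<Sum>p<d. L $$ (i, p) * B $$ (p, j))"
      by (rule sum.mono_neutral_cong_right) (use dk ij in \<open>auto simp: L'_def B'_def\<close>)
    also have "\<dots> = (L * B) $$ (i, j)"
      using ij by (intro mult_mat_entry[OF L B, symmetric])
    finally show "(L' * B') $$ (i, j) = 1\<^sub>m k $$ (i, j)" by (simp add: LB)
  qed (use B' L' in auto)
  hence "B' * L' = 1\<^sub>m k" by (rule mat_mult_left_right_inverse[OF L' B'])
  hence "(\<Sum>p<k. B' $$ (d, p) * L' $$ (p, d)) = 1"
    using dk by (simp flip: mult_mat_entry[OF B' L' dk dk])
  thus False using dk by (simp add: B'_def)
qed

text \<open>The columns of \<open>B\<close> are a basis of \<open>W\<close>, and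
  \<open>B * L\<close> is a projection onto it. In this form a subrepresentation is simply
  \<open>L * (\<rho> g * B)\<close>. A pair with the greatest possible number of columns works,
  since otherwise one more column could be added.\<close>

lemma subspace_frame_exists:
  fixes W :: "'a::field vec set"
  assumes W: "VectorSpace.subspace class_ring W (module_vec TYPE('a) d)"
  obtains k B L where "B \<in> carrier_mat d k" "L \<in> carrier_mat k d" "L * B = 1\<^sub>m k"
    "W = {w \<in> carrier_vec d. B *\<^sub>v (L *\<^sub>v w) = w}"
proof -
  note W = W[unfolded subspace_module_vec_iff]
  define P where "P k \<longleftrightarrow> (\<exists>B L. B \<in> carrier_mat d k \<and> L \<in> carrier_mat k d \<and> L * B = 1\<^sub>m k \<and>
    (\<forall>x\<in>carrier_vec k. B *\<^sub>v x \<in> W))" for k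
  have "0\<^sub>m d 0 *\<^sub>v x \<in> W" if "x \<in> carrier_vec 0" for x :: "'a vec"
  proof -
    have "0\<^sub>m d 0 *\<^sub>v x = 0\<^sub>v d" using that by (intro eq_vecI) (auto simp: scalar_prod_def)
    thus ?thesis using W by simp
  qed
  hence "P 0" unfolding P_def
    by (intro exI[of _ "0\<^sub>m d 0"] exI[of _ "0\<^sub>m 0 d"]) auto
  moreover have "k \<le> d" if "P k" for k
    using that left_invertible_mat_dim_le unfolding P_def by blast
  ultimately obtain k where k: "P k" "\<And>k'. P k' \<Longrightarrow> k' \<le> k"
    using Nat.ex_has_greatest_nat[of P 0 d] by auto
  then obtain B L where B: "B \<in> carrier_mat d k" and L: "L \<in> carrier_mat k d"
    and LB: "L * B = 1\<^sub>m k" and BW: "\<And>x. x \<in> carrier_vec k \<Longrightarrow> B *\<^sub>v x \<in> W"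
    unfolding P_def by blast
  have "B *\<^sub>v (L *\<^sub>v w) = w" if w: "w \<in> W" for w
  proof (rule ccontr)
    assume neq: "B *\<^sub>v (L *\<^sub>v w) \<noteq> w"
    have wd: "w \<in> carrier_vec d" using W w by blast
    \<comment> \<open>The residue of \<open>w\<close> under the projection: it is nonzero, lies in
      \<open>W\<close>, is killed by \<open>L\<close>, and becomes the new column.\<close>
    define u where "u = w + (-1) \<cdot>\<^sub>v (B *\<^sub>v (L *\<^sub>v w))"
    have ud: "u \<in> carrier_vec d" using wd B L by (auto simp: u_def)
    have "(-1) \<cdot>\<^sub>v (B *\<^sub>v (L *\<^sub>v w)) \<in> W" using W BW[of "L *\<^sub>v w"] L wd by simp
    hence uW: "u \<in> W" using W w by (simp add: u_def)
    have Lu: "L *\<^sub>v u = 0\<^sub>v k"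
    proof -
      have "L *\<^sub>v u = L *\<^sub>v w + (-1) \<cdot>\<^sub>v ((L * B) *\<^sub>v (L *\<^sub>v w))"
        using wd B L by (simp add: u_def mult_add_distrib_mat_vec[of _ k d] mult_mat_vec[of _ k d]
            assoc_mult_mat_vec[of _ k d _ k])
      also have "\<dots> = 0\<^sub>v k" using L wd by (intro eq_vecI) (simp_all add: LB)
      finally show ?thesis .
    qed
    have "u \<noteq> 0\<^sub>v d"
    proof
      assume "u = 0\<^sub>v d"
      hence "u $ i = 0" if "i < d" for i using that by simp
      hence "B *\<^sub>v (L *\<^sub>v w) = w" using wd B by (intro eq_vecI) (auto simp: u_def)
      thus False using neq by simp
    qed
    then obtain i where i: "i < d" "u $ i \<noteq> 0" using ud by (auto simp: vec_eq_iff)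
    define r where "r p = ((if p = i then 1 else 0) - (B * L) $$ (i, p)) / u $ i" for p
    \<comment> \<open>\<open>r\<close> is the row \<open>(e\<^sub>i - e\<^sub>i B L) / u\<^sub>i\<close>, which annihilates \<open>B\<close> and sends \<open>u\<close> to 1.\<close>
    have rB: "(\<Sum>p<d. r p * B $$ (p, j)) = 0" if j: "j < k" for j
    proof -
      have "(\<Sum>p<d. (B * L) $$ (i, p) * B $$ (p, j)) = ((B * L) * B) $$ (i, j)"
        using B L i j by (intro mult_mat_entry[symmetric, of _ d d _ k]) auto
      also have "\<dots> = B $$ (i, j)" using B L by (simp add: assoc_mult_mat[of _ d k _ d _ k] LB)
      finally have *: "(\<Sum>p<d. (B * L) $$ (i, p) * B $$ (p, j)) = B $$ (i, j)" .
      have "(\<Sum>p<d. r p * B $$ (p, j)) =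
          ((\<Sum>p<d. (if p = i then B $$ (p, j) else 0)) - (\<Sum>p<d. (B * L) $$ (i, p) * B $$ (p, j))) / u $ i"
        unfolding sum_subtractf[symmetric] sum_divide_distrib r_def
        by (intro sum.cong refl) (auto simp: algebra_simps)
      also have "\<dots> = 0" unfolding * using i by simp
      finally show ?thesis .
    qed
    have ru: "(\<Sum>p<d. r p * u $ p) = 1"
    proof -
      have "(\<Sum>p<d. (B * L) $$ (i, p) * u $ p) = ((B * L) *\<^sub>v u) $ i"
        using B L i ud by (intro mult_mat_vec_entry[symmetric, of _ d d]) auto
      also have "\<dots> = 0" using B L ud i by (simp add: assoc_mult_mat_vec[of _ d k _ d] Lu)
      finally have *: "(\<Sum>p<d. (B * L) $$ (i, p) * u $ p) = 0" .
      have "(\<Sum>p<d. r p * u $ p) =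
          ((\<Sum>p<d. (if p = i then u $ p else 0)) - (\<Sum>p<d. (B * L) $$ (i, p) * u $ p)) / u $ i"
        unfolding sum_subtractf[symmetric] sum_divide_distrib r_def
        by (intro sum.cong refl) (auto simp: algebra_simps)
      also have "\<dots> = 1" unfolding * using i by simp
      finally show ?thesis .
    qed
    define B' where "B' = mat d (Suc k) (\<lambda>(p, j). if j < k then B $$ (p, j) else u $ p)"
    define L' where "L' = mat (Suc k) d (\<lambda>(j, p). if j < k then L $$ (j, p) else r p)"
    have B': "B' \<in> carrier_mat d (Suc k)" and L': "L' \<in> carrier_mat (Suc k) d"
      by (auto simp: B'_def L'_def)
    have LB_entry: "(\<Sum>p<d. L $$ (a, p) * B $$ (p, b)) = (if a = b then 1 else 0)" if "a < k" "b < k" for a b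
      using that by (simp flip: mult_mat_entry[OF L B] add: LB)
    have Lu_entry: "(\<Sum>p<d. L $$ (a, p) * u $ p) = 0" if "a < k" for a
      using that by (simp flip: mult_mat_vec_entry[OF L ud] add: Lu)
    have "L' * B' = 1\<^sub>m (Suc k)"
    proof (rule eq_matI)
      fix a b assume "a < dim_row (1\<^sub>m (Suc k))" "b < dim_col (1\<^sub>m (Suc k))"
      hence ab: "a < Suc k" "b < Suc k" by auto
      have "(L' * B') $$ (a, b) = (\<Sum>p<d. L' $$ (a, p) * B' $$ (p, b))"
        using ab by (rule mult_mat_entry[OF L' B'])
      also have "\<dots> = (\<Sum>p<d. (if a < k then L $$ (a, p) else r p) * (if b < k then B $$ (p, b) else u $ p))"
        using ab by (intro sum.cong) (auto simp: B'_def L'_def)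
      also have "\<dots> = (if a = b then 1 else 0)"
        using ab LB_entry[of a b] Lu_entry[of a] rB[of b] ru by (cases "a < k"; cases "b < k") auto
      finally show "(L' * B') $$ (a, b) = 1\<^sub>m (Suc k) $$ (a, b)" using ab by simp
    qed (use B' L' in auto)
    moreover have "B' *\<^sub>v x \<in> W" if x: "x \<in> carrier_vec (Suc k)" for x
    proof -
      have "B *\<^sub>v vec_first x k + (x $ k) \<cdot>\<^sub>v u \<in> W"
        using W uW BW[of "vec_first x k"] by simp
      also have "B *\<^sub>v vec_first x k + (x $ k) \<cdot>\<^sub>v u = B' *\<^sub>v x"
      proof (rule eq_vecI)
        fix p assume "p < dim_vec (B' *\<^sub>v x)"
        hence p: "p < d" using B' by simp
        show "(B *\<^sub>v vec_first x k + (x $ k) \<cdot>\<^sub>v u) $ p = (B' *\<^sub>v x) $ p"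
          using p ud B x
          by (simp add: mult_mat_vec_entry[OF B' x] mult_mat_vec_entry[OF B] del: index_mult_mat_vec)
            (simp add: B'_def vec_first_def mult.commute)
      qed (use B B' ud in auto)
      finally show ?thesis .
    qed
    ultimately have "P (Suc k)" using B' L' unfolding P_def by blast
    thus False using k(2) by force
  qed
  moreover have "w \<in> W" if "w \<in> carrier_vec d" "B *\<^sub>v (L *\<^sub>v w) = w" for w
    using BW[of "L *\<^sub>v w"] L that by simp
  ultimately have "W = {w \<in> carrier_vec d. B *\<^sub>v (L *\<^sub>v w) = w}" using W by blast
  thus ?thesis using that B L LB by blast
qed

text \<open>Least dimension replaces complete reducibility: compressing to a proper nonzero
  invariant subspace keeps the scalars on \<open>S\<close> and would lower the dimension.\<close>

lemma (in group) irreducible_rep_exists: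
  assumes hom: "\<rho> \<in> hom G (GL d)" and d: "d > 0" and S: "S \<subseteq> carrier G"
    and scalar: "\<And>s. s \<in> S \<Longrightarrow> \<rho> s = f s \<cdot>\<^sub>m 1\<^sub>m d"
  obtains d' \<rho>' where "irreducible_rep G d' \<rho>'" "\<And>s. s \<in> S \<Longrightarrow> \<rho>' s = f s \<cdot>\<^sub>m 1\<^sub>m d'"
proof -
  define P where "P d \<longleftrightarrow> d > 0 \<and> (\<exists>\<rho>\<in>hom G (GL d). \<forall>s\<in>S. \<rho> s = f s \<cdot>\<^sub>m 1\<^sub>m d)" for d
  have "P d" using assms by (auto simp: P_def)
  hence "P (LEAST d. P d)" by (rule LeastI)
  then obtain m \<rho> where m: "m = (LEAST d. P d)" "m > 0" and \<rho>: "\<rho> \<in> hom G (GL m)"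
    and sc: "\<And>s. s \<in> S \<Longrightarrow> \<rho> s = f s \<cdot>\<^sub>m 1\<^sub>m m"
    unfolding P_def by blast
  note H = \<rho>[unfolded hom_GL_iff]
  have car: "\<rho> g \<in> carrier_mat m m" if "g \<in> carrier G" for g using H that by blast
  have "W = {0\<^sub>v m} \<or> W = carrier_vec m"
    if W: "VectorSpace.subspace class_ring W (module_vec TYPE(complex) m)"
      and inv: "\<forall>g\<in>carrier G. \<forall>w\<in>W. \<rho> g *\<^sub>v w \<in> W" for W
  proof -
    obtain k B L where B: "B \<in> carrier_mat m k" and L: "L \<in> carrier_mat k m" and LB: "L * B = 1\<^sub>m k"
      and WBL: "W = {w \<in> carrier_vec m. B *\<^sub>v (L *\<^sub>v w) = w}"
      by (rule subspace_frame_exists[OF W])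
    have BW: "B *\<^sub>v x \<in> W" if "x \<in> carrier_vec k" for x
    proof -
      have "L *\<^sub>v (B *\<^sub>v x) = x"
        using assoc_mult_mat_vec[OF L B that] LB that by (metis one_mult_mat_vec)
      thus ?thesis using B that by (simp add: WBL)
    qed
    consider "k = 0" | "k = m" | "k > 0" "k < m"
      using left_invertible_mat_dim_le[OF B L LB] by force
    thus ?thesis
    proof cases
      case 1
      have "w = 0\<^sub>v m" if "w \<in> W" for w
      proof -
        have "w = B *\<^sub>v (L *\<^sub>v w)" "w \<in> carrier_vec m" using that by (auto simp: WBL)
        moreover have "B *\<^sub>v x = 0\<^sub>v m" if "x \<in> carrier_vec k" for x
          using that 1 B by (intro eq_vecI) (auto simp: scalar_prod_def)
        ultimately show ?thesis using L by (metis mult_mat_vec_carrier)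
      qed
      thus ?thesis using W unfolding subspace_module_vec_iff by blast
    next
      case 2
      hence "B * L = 1\<^sub>m m" using B L LB mat_mult_left_right_inverse by blast
      hence "B *\<^sub>v (L *\<^sub>v w) = w" if "w \<in> carrier_vec m" for w
        using that B L assoc_mult_mat_vec[of B m k L m w] by simp
      thus ?thesis by (auto simp: WBL)
    next
      case 3
      \<comment> \<open>Invariance of \<open>W\<close> says that the projection \<open>B * L\<close>
        fixes the columns of \<open>\<rho> g * B\<close>; this makes the compression
        multiplicative.\<close>
      have BL: "B * (L * (\<rho> g * B)) = \<rho> g * B" if g: "g \<in> carrier G" for g
      proof (rule mat_eq_if_mult_vec_eq)
        fix x :: "complex vec" assume x: "x \<in> carrier_vec k"
        have "\<rho> g *\<^sub>v (B *\<^sub>v x) \<in> W" using inv g BW[OF x] by blast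
        hence "B *\<^sub>v (L *\<^sub>v (\<rho> g *\<^sub>v (B *\<^sub>v x))) = \<rho> g *\<^sub>v (B *\<^sub>v x)" by (simp add: WBL)
        thus "(B * (L * (\<rho> g * B))) *\<^sub>v x = (\<rho> g * B) *\<^sub>v x"
          using x car[OF g] B L
          by (simp add: assoc_mult_mat_vec[of _ m k _ k] assoc_mult_mat_vec[of _ k m _ k]
              assoc_mult_mat_vec[of _ m m _ k])
      qed (use car[OF g] B L in auto)
      define \<rho>' where "\<rho>' g = L * (\<rho> g * B)" for g
      have "\<rho>' \<in> hom G (GL k)"
        unfolding hom_GL_iff
      proof (intro conjI ballI)
        show "\<rho>' \<one> = 1\<^sub>m k" using H B LB by (simp add: \<rho>'_def)
        fix g h assume g: "g \<in> carrier G" and h: "h \<in> carrier G"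
        have "\<rho>' (g \<otimes> h) = L * (\<rho> g * \<rho> h * B)" using H g h by (simp add: \<rho>'_def)
        also have "\<dots> = L * (\<rho> g * (\<rho> h * B))"
          using car[OF g] car[OF h] B by (simp add: assoc_mult_mat[of _ m m _ m _ k])
        also have "\<dots> = L * (\<rho> g * (B * \<rho>' h))" by (simp add: BL[OF h] \<rho>'_def)
        also have "\<dots> = L * (\<rho> g * B * \<rho>' h)"
          using car[OF g] car[OF h] B L by (subst assoc_mult_mat[of _ m m _ k _ k]) (auto simp: \<rho>'_def)
        also have "\<dots> = \<rho>' g * \<rho>' h"
          using car[OF g] car[OF h] B L unfolding \<rho>'_def[of g]
          by (subst assoc_mult_mat[of L k m "\<rho> g * B" k "\<rho>' h" k]) (auto simp: \<rho>'_def)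
        finally show "\<rho>' (g \<otimes> h) = \<rho>' g * \<rho>' h" .
      qed (use car B L in \<open>auto simp: \<rho>'_def\<close>)
      moreover have "\<rho>' s = f s \<cdot>\<^sub>m 1\<^sub>m k" if "s \<in> S" for s
        using B L LB by (simp add: \<rho>'_def sc[OF that] mult_smult_assoc_mat[of _ m m _ k] mult_smult_distrib[of _ k m _ k])
      ultimately have "P k" using 3 by (auto simp: P_def)
      hence "m \<le> k" unfolding m(1) by (rule Least_le)
      thus ?thesis using 3 by simp
    qed
  qed
  hence "irreducible_rep G m \<rho>" using \<rho> m(2) unfolding irreducible_rep_def by blast
  thus ?thesis using that sc by blast
qed

section \<open>Additive characters of finite fields\<close>

locale additive_character =
  fixes \<theta> :: "'a::{field,finite} \<Rightarrow> complex"
  assumes add: "\<theta> (x + y) = \<theta> x * \<theta> y"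
    and zero [simp]: "\<theta> 0 = 1"
    and nontrivial: "\<exists>x. \<theta> x \<noteq> 1"

text \<open>An additive subgroup that is maximal among those avoiding 1 is a complement of the prime
  field, and the projection to the prime field is composed with a character of it.\<close>

theorem additive_character_exists: "\<exists>\<theta> :: 'a::{field,finite} \<Rightarrow> complex. additive_character \<theta>"
proof -
  define p where "p = CHAR('a)"
  have p0: "p > 0" unfolding p_def by (rule finite_imp_CHAR_pos) simp
  have prime: "prime p" using p0 prime_CHAR_semidom unfolding p_def by blast
  \<comment> \<open>Closure under negation follows from closure under addition, because
    \<open>- x\<close> is the multiple of \<open>x\<close> by \<open>p - 1\<close>.\<close>
  define sg where "sg M \<longleftrightarrow> (0::'a) \<in> M \<and> (\<forall>x\<in>M. \<forall>y\<in>M. x + y \<in> M) \<and> 1 \<notin> M" for M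
  have "sg {0}" by (simp add: sg_def)
  then obtain M where M: "sg M" and max: "\<And>M'. sg M' \<Longrightarrow> M \<subseteq> M' \<Longrightarrow> M' = M"
    using finite_has_maximal[of "{M. sg M}"] by auto
  have add: "x + y \<in> M" if "x \<in> M" "y \<in> M" for x y using M that by (auto simp: sg_def)
  have mult: "of_nat k * x \<in> M" if "x \<in> M" for k x
    by (induction k) (use M that in \<open>auto simp: sg_def distrib_right\<close>)
  have neg: "- x \<in> M" if "x \<in> M" for x
  proof -
    have "of_nat (p - 1) * x = - x"
      using p0 by (simp add: of_nat_diff) (simp add: p_def)
    thus ?thesis using mult[OF that, of "p - 1"] by simp
  qed
  have unit: "\<exists>l. of_nat j * of_nat l = (1::'a)" if "\<not> p dvd j" for j
  proof -
    have "coprime j p" using prime that by (metis coprime_commute prime_imp_coprime)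
    then obtain l where "[j * l = Suc 0] (mod p)" using cong_solve_coprime_nat by blast
    hence "of_nat (j * l) = (of_nat (Suc 0) :: 'a)" unfolding of_nat_eq_iff_cong_CHAR p_def .
    thus ?thesis by auto
  qed
  have ofnat_M: "p dvd j" if "of_nat j \<in> M" for j
  proof (rule ccontr)
    assume "\<not> p dvd j"
    then obtain l where "of_nat j * of_nat l = (1::'a)" using unit by blast
    moreover have "of_nat l * of_nat j \<in> M" using mult[OF that] .
    ultimately show False using M by (simp add: sg_def mult.commute)
  qed
  have ex: "\<exists>k. x - of_nat k \<in> M" for x
  proof (cases "x \<in> M")
    case True
    thus ?thesis by (intro exI[of _ 0]) simp
  next
    case False
    \<comment> \<open>The additive monoid generated by \<open>M\<close> and \<open>x\<close>.
      Maximality forces 1 into it, and an inverse of \<open>j\<close> modulo \<open>p\<close> solves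
      the resulting equation for \<open>x\<close> modulo \<open>M\<close>.\<close>
    define M' where "M' = {m + of_nat j * x | m j. m \<in> M}"
    have "M \<subseteq> M'" unfolding M'_def by (force intro: exI[of _ "0::nat"])
    moreover have "x \<in> M'" using M unfolding M'_def sg_def by (force intro: exI[of _ "1::nat"])
    moreover have "0 \<in> M'" using \<open>M \<subseteq> M'\<close> M by (auto simp: sg_def)
    moreover have "u + v \<in> M'" if uv: "u \<in> M'" "v \<in> M'" for u v
    proof -
      obtain m j m' j' where "u = m + of_nat j * x" "v = m' + of_nat j' * x" "m \<in> M" "m' \<in> M"
        using uv unfolding M'_def by blast
      hence "u + v = (m + m') + of_nat (j + j') * x" "m + m' \<in> M"
        using add by (auto simp: algebra_simps)
      thus ?thesis unfolding M'_def by blast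
    qed
    ultimately have "1 \<in> M'" using max[of M'] False unfolding sg_def by blast
    then obtain m j where mj: "1 = m + of_nat j * x" "m \<in> M" unfolding M'_def by blast
    have "\<not> p dvd j"
      using mj M by (auto simp: p_def sg_def simp flip: of_nat_eq_0_iff_char_dvd)
    then obtain l where l: "of_nat j * of_nat l = (1::'a)" using unit by blast
    have "of_nat l = of_nat l * m + (of_nat j * of_nat l) * x"
      using arg_cong[OF mj(1), of "\<lambda>z. of_nat l * z"] by (simp add: algebra_simps)
    hence "x = of_nat l - of_nat l * m" unfolding l mult_1 eq_diff_eq by (metis add.commute)
    hence "x - of_nat l = - (of_nat l * m)" by simp
    thus ?thesis using neg[OF mult[OF mj(2), of l]] by metis
  qed
  define \<omega> where "\<omega> = cis (2 * pi / of_nat p)"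
  have \<omega>p: "\<omega> ^ p = 1" using p0 by (simp add: \<omega>_def DeMoivre)
  have \<omega>1: "\<omega> \<noteq> 1"
  proof
    assume "\<omega> = 1"
    hence "cos (2 * pi / p) = 1" by (simp add: \<omega>_def complex_eq_iff)
    then obtain n :: int where "2 * pi / p = n * 2 * pi" by (auto simp: cos_one_2pi_int)
    hence "1 = real_of_int n * real p" using p0 by (simp add: field_simps)
    hence "n * int p = 1" by (metis of_int_1 of_int_eq_iff of_int_mult of_int_of_nat_eq)
    hence "int p dvd 1" by (metis dvd_triv_right)
    thus False using prime by simp
  qed
  have mono: "\<omega> ^ k = \<omega> ^ l" if "x - of_nat k \<in> M" "x - of_nat l \<in> M" "k \<le> l" for x k l
  proof -
    have "(x - of_nat k) + - (x - of_nat l) \<in> M" using add neg that by blast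
    hence "of_nat (l - k) \<in> M" using that(3) by (simp add: of_nat_diff)
    then obtain r where "l - k = p * r" using ofnat_M by blast
    hence "l = k + p * r" using that(3) by simp
    thus ?thesis by (simp add: power_add power_mult \<omega>p)
  qed
  have mono': "\<omega> ^ k = \<omega> ^ l" if "x - of_nat k \<in> M" "x - of_nat l \<in> M" for x k l
  proof (cases "k \<le> l")
    case False
    hence "\<omega> ^ l = \<omega> ^ k" by (intro mono[OF that(2,1)]) simp
    thus ?thesis ..
  qed (rule mono[OF that])
  \<comment> \<open>The choice of \<open>k\<close> is harmless: two choices differ by a multiple of
    \<open>p\<close>, and \<open>\<omega>\<close> is a \<open>p\<close>-th root of unity.\<close>
  define \<theta> where "\<theta> x = \<omega> ^ (SOME k. x - of_nat k \<in> M)" for x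
  have \<theta>: "\<theta> x = \<omega> ^ k" if "x - of_nat k \<in> M" for x k
    unfolding \<theta>_def by (rule someI2[of _ k], rule that, rule mono', assumption, rule that)
  have "additive_character \<theta>"
  proof
    fix x y :: 'a
    obtain k l where kl: "x - of_nat k \<in> M" "y - of_nat l \<in> M" using ex by meson
    have "(x - of_nat k) + (y - of_nat l) \<in> M" using kl add by blast
    hence "(x + y) - of_nat (k + l) \<in> M" by (simp add: algebra_simps)
    from \<theta>[OF this] show "\<theta> (x + y) = \<theta> x * \<theta> y" using \<theta> kl by (simp add: power_add)
  next
    show "\<theta> 0 = 1" using \<theta>[of 0 0] M by (simp add: sg_def)
    show "\<exists>x. \<theta> x \<noteq> 1" using \<theta>[of 1 1] M \<omega>1 by (auto simp: sg_def)
  qed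
  thus ?thesis by blast
qed

section \<open>Character sums over vectors of a finite field\<close>

lemma finite_carrier_vec [simp, intro]: "finite (carrier_vec n :: 'a::finite vec set)"
proof -
  have "carrier_vec n \<subseteq> (vec n :: _ \<Rightarrow> 'a vec) ` (\<Pi>\<^sub>E i\<in>{..<n}. UNIV)"
  proof
    fix v :: "'a vec" assume "v \<in> carrier_vec n"
    thus "v \<in> vec n ` (\<Pi>\<^sub>E i\<in>{..<n}. UNIV)"
      by (intro image_eqI[where x = "restrict (($) v) {..<n}"]) auto
  qed
  thus ?thesis by (rule finite_subset) (simp add: finite_PiE)
qed

lemma carrier_vec_nonempty [simp]: "(carrier_vec n :: 'a::zero vec set) \<noteq> {}"
  by (metis empty_iff zero_carrier_vec)

definition vec_subgroup :: "nat \<Rightarrow> 'a::ab_group_add vec set \<Rightarrow> bool" where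
  "vec_subgroup n R \<longleftrightarrow> R \<subseteq> carrier_vec n \<and> 0\<^sub>v n \<in> R \<and>
     (\<forall>a\<in>R. \<forall>b\<in>R. a + b \<in> R) \<and> (\<forall>a\<in>R. - a \<in> R)"

lemma vec_subgroup_carrier_vec: "vec_subgroup n (carrier_vec n)"
  by (auto simp: vec_subgroup_def)

lemma vec_subgroup_shift:
  assumes R: "vec_subgroup n R" and r: "r \<in> R"
  shows "(\<Sum>a\<in>R. f (r + a)) = (\<Sum>a\<in>R. f a)"
proof -
  have [simp]: "a \<in> carrier_vec n" "dim_vec a = n" if "a \<in> R" for a
    using R that by (auto simp: vec_subgroup_def)
  have 1: "- r + (r + a) = a" "r + (- r + a) = a" if "a \<in> R" for a
    using that r by (auto intro!: eq_vecI)
  show ?thesis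
    by (rule sum.reindex_bij_witness[where j = "\<lambda>a. r + a" and i = "\<lambda>a. - r + a"])
      (use R r 1 in \<open>auto simp: vec_subgroup_def\<close>)
qed

lemma sum_character_eq_0:
  fixes \<nu> :: "'a::ab_group_add vec \<Rightarrow> complex"
  assumes R: "vec_subgroup n R"
    and mult: "\<And>a b. a \<in> R \<Longrightarrow> b \<in> R \<Longrightarrow> \<nu> (a + b) = \<nu> a * \<nu> b"
    and r: "r \<in> R" "\<nu> r \<noteq> 1"
  shows "(\<Sum>a\<in>R. \<nu> a) = 0"
proof -
  have "(\<Sum>a\<in>R. \<nu> a) = (\<Sum>a\<in>R. \<nu> (r + a))" by (rule vec_subgroup_shift[OF R r(1), symmetric])
  also have "\<dots> = \<nu> r * (\<Sum>a\<in>R. \<nu> a)" using mult r by (simp add: sum_distrib_left)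
  finally show ?thesis using r(2) by (simp add: algebra_simps)
qed

context additive_character
begin

lemma nonzero [simp]: "\<theta> x \<noteq> 0"
proof
  assume "\<theta> x = 0"
  thus False using add[of x "- x"] by simp
qed

lemma minus: "\<theta> (- x) = inverse (\<theta> x)"
  using add[of x "- x"] by (simp add: field_simps)

lemma diff: "\<theta> (x - y) = \<theta> x / \<theta> y"
  using add[of x "- y"] by (simp add: minus field_simps)

text \<open>Nondegeneracy of the pairing \<open>\<theta> (y \<bullet> a)\<close>: if
  \<open>y $ i\<close> is nonzero, then \<open>y \<bullet> a\<close> takes every value on the
  multiples of one unit vector, among them a value where \<open>\<theta>\<close> is not 1.\<close>

lemma scalar_prod_eq_0:
  assumes y: "y \<in> carrier_vec n" and triv: "\<And>a. a \<in> carrier_vec n \<Longrightarrow> \<theta> (y \<bullet> a) = 1"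
  shows "y = 0\<^sub>v n"
proof (rule eq_vecI)
  fix i assume "i < dim_vec (0\<^sub>v n)"
  hence i: "i < n" by simp
  obtain x where x: "\<theta> x \<noteq> 1" using nontrivial by blast
  have "y $ i = 0"
  proof (rule ccontr)
    assume "y $ i \<noteq> 0"
    hence "y \<bullet> ((x / y $ i) \<cdot>\<^sub>v unit_vec n i) = x"
      using y i by (simp add: scalar_prod_smult_distrib[of _ n])
    thus False using x triv[of "(x / y $ i) \<cdot>\<^sub>v unit_vec n i"] by simp
  qed
  thus "y $ i = 0\<^sub>v n $ i" using i by simp
qed (use y in auto)

lemma sum_scalar_prod:
  assumes y: "y \<in> carrier_vec n"
  shows "(\<Sum>a\<in>carrier_vec n. \<theta> (y \<bullet> a)) =
    (if y = 0\<^sub>v n then of_nat (card (carrier_vec n :: 'a vec set)) else 0)"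
proof (cases "y = 0\<^sub>v n")
  case False
  then obtain a where "a \<in> carrier_vec n" "\<theta> (y \<bullet> a) \<noteq> 1"
    using scalar_prod_eq_0[OF y] by blast
  hence "(\<Sum>a\<in>carrier_vec n. \<theta> (y \<bullet> a)) = 0"
    by (intro sum_character_eq_0[OF vec_subgroup_carrier_vec])
      (auto simp: scalar_prod_add_distrib[OF y] add)
  thus ?thesis using False by simp
qed simp

text \<open>Fourier inversion at 0: some \<open>\<nu> a / \<theta> (y \<bullet> a)\<close> must have a nonzero sum over \<open>R\<close>.\<close>

lemma vec_subgroup_character_extends:
  assumes R: "vec_subgroup n R"
    and mult: "\<And>a b. a \<in> R \<Longrightarrow> b \<in> R \<Longrightarrow> \<nu> (a + b) = \<nu> a * \<nu> b"
    and nz: "\<nu> (0\<^sub>v n) = 1"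
  shows "\<exists>y\<in>carrier_vec n. \<forall>a\<in>R. \<nu> a = \<theta> (y \<bullet> a)"
proof -
  have RV: "R \<subseteq> carrier_vec n" and R0: "0\<^sub>v n \<in> R" using R by (auto simp: vec_subgroup_def)
  have fin: "finite R" using finite_subset[OF RV finite_carrier_vec] .
  let ?V = "carrier_vec n :: 'a vec set"
  have "(\<Sum>y\<in>?V. \<Sum>a\<in>R. \<nu> a * \<theta> (- (y \<bullet> a))) = (\<Sum>a\<in>R. \<nu> a * (\<Sum>y\<in>?V. \<theta> ((- a) \<bullet> y)))"
    by (subst sum.swap) (use RV in \<open>auto simp: sum_distrib_left comm_scalar_prod[of _ n] intro!: sum.cong\<close>)
  also have "\<dots> = (\<Sum>a\<in>R. if a = 0\<^sub>v n then of_nat (card ?V) else 0)"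
  proof (rule sum.cong[OF refl])
    fix a assume a: "a \<in> R"
    have "- a = 0\<^sub>v n \<longleftrightarrow> a = 0\<^sub>v n" using a RV by (auto simp: vec_eq_iff)
    thus "\<nu> a * (\<Sum>y\<in>?V. \<theta> ((- a) \<bullet> y)) = (if a = 0\<^sub>v n then of_nat (card ?V) else 0)"
      using a RV nz by (subst sum_scalar_prod) auto
  qed
  also have "\<dots> \<noteq> 0" using R0 fin by simp
  finally obtain y where y: "y \<in> ?V" "(\<Sum>a\<in>R. \<nu> a * \<theta> (- (y \<bullet> a))) \<noteq> 0"
    by (metis (no_types, lifting) sum.neutral)
  have "\<nu> a = \<theta> (y \<bullet> a)" if a: "a \<in> R" for a
  proof -
    have "\<nu> a * \<theta> (- (y \<bullet> a)) = 1"
    proof (rule ccontr)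
      assume "\<nu> a * \<theta> (- (y \<bullet> a)) \<noteq> 1"
      hence "(\<Sum>a\<in>R. \<nu> a * \<theta> (- (y \<bullet> a))) = 0"
        using RV y(1) mult
        by (intro sum_character_eq_0[OF R _ a])
          (auto simp: scalar_prod_add_distrib[of _ n] add minus diff divide_inverse subset_iff)
      thus False using y(2) by simp
    qed
    thus ?thesis by (simp add: minus field_simps)
  qed
  thus ?thesis using y(1) by blast
qed

end

section \<open>The alternating form of a path\<close>

text \<open>The amount by which \<open>c \<bullet> superdiag2\<close> fails to be additive on
  products of unitriangular matrices. It is not antisymmetric; the alternating form is its
  difference under exchange of the arguments.\<close>

definition path_form :: "'a::field vec \<Rightarrow> 'a vec \<Rightarrow> 'a vec \<Rightarrow> 'a" where
  "path_form c x y = (\<Sum>i<dim_vec c. c $ i * x $ i * y $ Suc i)"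

text \<open>The vector representing the functional
  \<open>a \<mapsto> path_form c v a - path_form c a v\<close>. The two guards drop the missing
  neighbours at the ends of the path.\<close>

definition path_grad :: "'a::field vec \<Rightarrow> 'a vec \<Rightarrow> 'a vec" where
  "path_grad c v = vec (Suc (dim_vec c)) (\<lambda>j.
     (if 0 < j then c $ (j - 1) * v $ (j - 1) else 0) - (if j < dim_vec c then c $ j * v $ Suc j else 0))"

definition path_radical :: "'a::field vec \<Rightarrow> 'a vec set" where
  "path_radical c = {a \<in> carrier_vec (Suc (dim_vec c)). path_grad c a = 0\<^sub>v (Suc (dim_vec c))}"

lemma path_form_add_left:
  "x \<in> carrier_vec (Suc (dim_vec c)) \<Longrightarrow> x' \<in> carrier_vec (Suc (dim_vec c)) \<Longrightarrow>
    path_form c (x + x') y = path_form c x y + path_form c x' y"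
  unfolding path_form_def sum.distrib[symmetric] by (intro sum.cong) (auto simp: algebra_simps)

lemma path_form_add_right:
  "y \<in> carrier_vec (Suc (dim_vec c)) \<Longrightarrow> y' \<in> carrier_vec (Suc (dim_vec c)) \<Longrightarrow>
    path_form c x (y + y') = path_form c x y + path_form c x y'"
  unfolding path_form_def sum.distrib[symmetric] by (intro sum.cong) (auto simp: algebra_simps)

lemma path_grad_carrier [simp]: "path_grad c v \<in> carrier_vec (Suc (dim_vec c))"
  by (simp add: path_grad_def)

lemma dim_path_grad [simp]: "dim_vec (path_grad c v) = Suc (dim_vec c)"
  by (simp add: path_grad_def)

lemma path_grad_scalar_prod:
  assumes "a \<in> carrier_vec (Suc (dim_vec c))"
  shows "path_grad c v \<bullet> a = path_form c v a - path_form c a v"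
proof -
  let ?k = "dim_vec c"
  have "path_grad c v \<bullet> a =
      (\<Sum>j<Suc ?k. (if 0 < j then c $ (j - 1) * v $ (j - 1) else 0) * a $ j) -
      (\<Sum>j<Suc ?k. (if j < ?k then c $ j * v $ Suc j else 0) * a $ j)"
    using assms unfolding scalar_prod_def sum_subtractf[symmetric] path_grad_def
    by (intro sum.cong) (auto simp: algebra_simps)
  also have "(\<Sum>j<Suc ?k. (if 0 < j then c $ (j - 1) * v $ (j - 1) else 0) * a $ j) = path_form c v a"
    by (subst sum.lessThan_Suc_shift) (simp add: path_form_def)
  also have "(\<Sum>j<Suc ?k. (if j < ?k then c $ j * v $ Suc j else 0) * a $ j) = path_form c a v"
    by (simp add: path_form_def mult_ac)
  finally show ?thesis .
qed

lemma path_grad_add: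
  assumes "x \<in> carrier_vec (Suc (dim_vec c))" "y \<in> carrier_vec (Suc (dim_vec c))"
  shows "path_grad c (x + y) = path_grad c x + path_grad c y"
  using assms by (intro eq_vecI) (auto simp: path_grad_def algebra_simps)

lemma path_grad_minus:
  assumes "x \<in> carrier_vec (Suc (dim_vec c))"
  shows "path_grad c (- x) = - path_grad c x"
  using assms by (intro eq_vecI) (auto simp: path_grad_def algebra_simps)

lemma vec_subgroup_path_radical: "vec_subgroup (Suc (dim_vec c)) (path_radical c)"
  unfolding vec_subgroup_def path_radical_def
  by (auto simp: path_grad_add path_grad_minus) (auto simp: path_grad_def)

lemma path_radical_symmetric:
  assumes "a \<in> path_radical c" "v \<in> carrier_vec (Suc (dim_vec c))"
  shows "path_form c a v = path_form c v a"
  using assms path_grad_scalar_prod[of v c a] by (simp add: path_radical_def)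

text \<open>The radical equations read \<open>c $ 0 * a $ 1 = 0\<close> and
  \<open>c $ i * a $ i = c $ Suc i * a $ Suc (Suc i)\<close>. They push each term of the form down
  the path, with the two vectors exchanged at every step, until a factor of the first kind appears.
  Vanishing of the alternating form by itself would give only symmetry.\<close>

lemma path_radical_isotropic:
  assumes "a \<in> path_radical c" "b \<in> path_radical c"
  shows "path_form c a b = 0"
proof -
  have rad0: "c $ 0 * x $ 1 = 0" if "x \<in> path_radical c" "0 < dim_vec c" for x
  proof -
    have "path_grad c x $ 0 = 0" using that by (simp add: path_radical_def)
    thus ?thesis using that by (simp add: path_grad_def)
  qed
  have radS: "c $ i * x $ i = c $ Suc i * x $ Suc (Suc i)"
    if "x \<in> path_radical c" "Suc i < dim_vec c" for x i
  proof -
    have "path_grad c x $ Suc i = 0" using that by (simp add: path_radical_def)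
    thus ?thesis using that by (simp add: path_grad_def)
  qed
  have *: "i < dim_vec c \<Longrightarrow> c $ i * x $ i * y $ Suc i = 0"
    if "x \<in> path_radical c" "y \<in> path_radical c" for x y i
    using that
  proof (induction i arbitrary: x y)
    case 0
    thus ?case using rad0[of y] by auto
  next
    case (Suc i)
    have "c $ Suc i * x $ Suc i * y $ Suc (Suc i) = x $ Suc i * (c $ i * y $ i)"
      using radS[of y i] Suc.prems by (simp add: mult_ac)
    also have "\<dots> = 0" using Suc.IH[of y x] Suc.prems by (auto simp: mult_ac)
    finally show ?case .
  qed
  show ?thesis unfolding path_form_def by (intro sum.neutral ballI *) (use assms in auto)
qed

lemma card_path_grad_fibre:
  fixes c :: "'a::{field,finite} vec"
  shows "card {v \<in> carrier_vec (Suc (dim_vec c)). path_grad c v = y} =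
    (if y \<in> path_grad c ` carrier_vec (Suc (dim_vec c)) then card (path_radical c) else 0)"
proof (cases "y \<in> path_grad c ` carrier_vec (Suc (dim_vec c))")
  case True
  then obtain x where x: "x \<in> carrier_vec (Suc (dim_vec c))" "y = path_grad c x" by blast
  have 1: "- x + (x + a) = a" "x + (- x + a) = a" if "a \<in> carrier_vec (Suc (dim_vec c))" for a
    using that x by (auto intro!: eq_vecI)
  have "bij_betw (\<lambda>a. x + a) (path_radical c) {v \<in> carrier_vec (Suc (dim_vec c)). path_grad c v = y}"
    by (rule bij_betw_byWitness[where f' = "\<lambda>v. - x + v"])
      (use x 1 in \<open>auto simp: path_radical_def path_grad_add path_grad_minus\<close>)
  from bij_betw_same_card[OF this] True show ?thesis by simp
qed (auto intro: card_eq_0_iff[THEN iffD2])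

lemma card_path_grad_image:
  fixes c :: "'a::{field,finite} vec"
  defines "V \<equiv> carrier_vec (Suc (dim_vec c)) :: 'a vec set"
  shows "card (path_grad c ` V) * card (path_radical c) = card V"
proof -
  have "card V = (\<Sum>y\<in>path_grad c ` V. card {v \<in> V. path_grad c v = y})"
    unfolding card_eq_sum V_def by (rule sum.image_gen) simp
  also have "\<dots> = (\<Sum>y\<in>path_grad c ` V. card (path_radical c))"
    by (intro sum.cong refl) (simp add: V_def card_path_grad_fibre)
  finally show ?thesis by simp
qed

context additive_character
begin

lemma path_radical_iff:
  assumes a: "a \<in> carrier_vec (Suc (dim_vec c))"
  shows "a \<in> path_radical c \<longleftrightarrow>
    (\<forall>v\<in>carrier_vec (Suc (dim_vec c)). \<theta> (path_form c a v - path_form c v a) = 1)"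
  using scalar_prod_eq_0[of "path_grad c a" "Suc (dim_vec c)"] assms
  by (auto simp: path_radical_def path_grad_scalar_prod[symmetric])

text \<open>For an alternating form the image is the annihilator of the radical. In the double sum
  of \<open>\<theta> ((path_grad c v - y) \<bullet> a)\<close>, summing over \<open>v\<close> first
  leaves only the \<open>a\<close> in the radical, each contributing \<open>card ?V\<close>. The
  total is nonzero, so some \<open>v\<close> has a nonzero inner sum over \<open>a\<close>, and this
  means \<open>path_grad c v = y\<close>.\<close>

lemma path_radical_annihilator:
  assumes y: "y \<in> carrier_vec (Suc (dim_vec c))"
  shows "(\<forall>a\<in>path_radical c. \<theta> (y \<bullet> a) = 1) \<longleftrightarrow> y \<in> path_grad c ` carrier_vec (Suc (dim_vec c))"
proof
  let ?V = "carrier_vec (Suc (dim_vec c)) :: 'a vec set"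
  assume triv: "\<forall>a\<in>path_radical c. \<theta> (y \<bullet> a) = 1"
  have rad: "path_radical c \<subseteq> ?V" by (auto simp: path_radical_def)
  have "(\<Sum>v\<in>?V. \<Sum>a\<in>?V. \<theta> ((path_grad c v - y) \<bullet> a)) =
      (\<Sum>a\<in>?V. \<theta> (- (y \<bullet> a)) * (\<Sum>v\<in>?V. \<theta> ((- path_grad c a) \<bullet> v)))"
    by (subst sum.swap)
      (use y in \<open>auto simp: sum_distrib_left path_grad_scalar_prod minus_scalar_prod_distrib[of _ "Suc (dim_vec c)"]
        uminus_scalar_prod[of _ "Suc (dim_vec c)", symmetric] add diff minus field_simps intro!: sum.cong\<close>)
  also have "\<dots> = (\<Sum>a\<in>?V. if a \<in> path_radical c then of_nat (card ?V) else 0)"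
  proof (rule sum.cong[OF refl])
    fix a assume a: "a \<in> ?V"
    have "- path_grad c a = 0\<^sub>v (Suc (dim_vec c)) \<longleftrightarrow> a \<in> path_radical c"
      using a by (auto simp: path_radical_def vec_eq_iff)
    thus "\<theta> (- (y \<bullet> a)) * (\<Sum>v\<in>?V. \<theta> ((- path_grad c a) \<bullet> v)) =
        (if a \<in> path_radical c then of_nat (card ?V) else 0)"
      using a triv by (subst sum_scalar_prod) (auto simp: minus)
  qed
  also have "\<dots> = of_nat (card (path_radical c) * card ?V)"
    using rad by (simp add: sum.If_cases Int_absorb1)
  also have "\<dots> \<noteq> 0"
  proof -
    have "0\<^sub>v (Suc (dim_vec c)) \<in> path_radical c"
      using vec_subgroup_path_radical[of c] by (simp add: vec_subgroup_def)
    hence "card (path_radical c) > 0" using finite_subset[OF rad] by (auto simp: card_gt_0_iff)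
    thus ?thesis by simp
  qed
  finally obtain v where v: "v \<in> ?V" "(\<Sum>a\<in>?V. \<theta> ((path_grad c v - y) \<bullet> a)) \<noteq> 0"
    by (metis (no_types, lifting) sum.neutral)
  hence "path_grad c v - y = 0\<^sub>v (Suc (dim_vec c))"
    using y sum_scalar_prod[of "path_grad c v - y" "Suc (dim_vec c)"] by (auto split: if_splits)
  hence "y = path_grad c v"
    using y by (auto simp: vec_eq_iff)
  thus "y \<in> path_grad c ` ?V" using v by blast
next
  assume "y \<in> path_grad c ` carrier_vec (Suc (dim_vec c))"
  thus "\<forall>a\<in>path_radical c. \<theta> (y \<bullet> a) = 1"
    using path_radical_symmetric[of _ c] vec_subgroup_path_radical[of c]
    by (auto simp: path_grad_scalar_prod vec_subgroup_def subset_iff)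
qed

end

section \<open>The unitriangular group\<close>

abbreviation unitriangular_mats :: "nat \<Rightarrow> 'a::field mat set" where
  "unitriangular_mats m \<equiv> carrier (unitriangular_group TYPE('a) m)"

lemma unitriangular_group_simps [simp]:
  "x \<otimes>\<^bsub>unitriangular_group TYPE('a::field) m\<^esub> y = x * y"
  "\<one>\<^bsub>unitriangular_group TYPE('a) m\<^esub> = 1\<^sub>m m"
  by (simp_all add: unitriangular_group_def)

lemma unitriangular_iff:
  "g \<in> unitriangular_mats m \<longleftrightarrow> g \<in> carrier_mat m m \<and>
    (\<forall>i<m. \<forall>j<i. g $$ (i, j) = 0) \<and> (\<forall>i<m. g $$ (i, i) = 1)"
  by (auto simp: unitriangular_group_def upper_triangular_def)

lemma unitriangularD:
  assumes "g \<in> unitriangular_mats m"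
  shows "g \<in> carrier_mat m m" "\<And>i j. j < i \<Longrightarrow> i < m \<Longrightarrow> g $$ (i, j) = 0"
    "\<And>i. i < m \<Longrightarrow> g $$ (i, i) = 1"
  using assms by (auto simp: unitriangular_iff)

lemma unitriangular_mult_entry:
  assumes g: "g \<in> unitriangular_mats m" and h: "h \<in> unitriangular_mats m" and ij: "i < m" "j < m"
  shows "(g * h) $$ (i, j) = (\<Sum>p\<in>{i..j}. g $$ (i, p) * h $$ (p, j))"
proof -
  note G = unitriangularD[OF g] and H = unitriangularD[OF h]
  have "(g * h) $$ (i, j) = (\<Sum>p<m. g $$ (i, p) * h $$ (p, j))"
    using ij by (rule mult_mat_entry[OF G(1) H(1)])
  also have "\<dots> = (\<Sum>p\<in>{i..j}. g $$ (i, p) * h $$ (p, j))"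
    by (rule sum.mono_neutral_right) (use ij G(2)[of _ i] H(2) in \<open>auto simp: not_le\<close>)
  finally show ?thesis .
qed

lemma one_unitriangular [simp]: "1\<^sub>m m \<in> unitriangular_mats m"
  by (auto simp: unitriangular_iff)

lemma mult_unitriangular:
  assumes g: "g \<in> unitriangular_mats m" and h: "h \<in> unitriangular_mats m"
  shows "g * h \<in> unitriangular_mats m"
  unfolding unitriangular_iff
  using unitriangularD[OF g] unitriangularD[OF h]
  by (auto simp: unitriangular_mult_entry[OF g h] simp del: index_mult_mat)

lemma addrow_mat_unitriangular [simp]:
  "i < j \<Longrightarrow> j < m \<Longrightarrow> addrow_mat m s i j \<in> unitriangular_mats m"
  by (auto simp: unitriangular_iff)

text \<open>Gaussian elimination, row by row and from left to right within each row.\<close>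

lemma unitriangular_induct [consumes 3, case_names one addrow]:
  fixes g :: "'a::field mat"
  assumes w: "0 < w" and g: "g \<in> unitriangular_mats m"
    and band: "\<forall>i j. i < j \<longrightarrow> j < i + w \<longrightarrow> j < m \<longrightarrow> g $$ (i, j) = 0"
    and one: "Q (1\<^sub>m m)"
    and addrow: "\<And>i j s g. i + w \<le> j \<Longrightarrow> j < m \<Longrightarrow> g \<in> unitriangular_mats m \<Longrightarrow>
      Q (addrow s i j g) \<Longrightarrow> Q g"
  shows "Q g"
proof -
  \<comment> \<open>Positions are numbered row by row as \<open>i * m + j\<close>. Those before
    \<open>N\<close> are already cleared above the diagonal, and \<open>r\<close> bounds the number
    left.\<close>
  have "Q g" if "m * m \<le> N + r" "g \<in> unitriangular_mats m"
    "\<And>i j. i < j \<Longrightarrow> j < i + w \<Longrightarrow> j < m \<Longrightarrow> g $$ (i, j) = 0"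
    "\<And>i j. i < j \<Longrightarrow> j < m \<Longrightarrow> i * m + j < N \<Longrightarrow> g $$ (i, j) = 0" for N r and g :: "'a mat"
    using that
  proof (induction r arbitrary: N g)
    case 0
    note D = unitriangularD[OF "0.prems"(2)]
    have "i * m + j < N" if "i < m" "j < m" for i j
    proof -
      have "i * m + j < i * m + m" using that by simp
      also have "\<dots> = Suc i * m" by simp
      also have "\<dots> \<le> m * m" using that by (intro mult_le_mono1) simp
      finally show ?thesis using "0.prems"(1) by simp
    qed
    hence "g $$ (i, j) = 1\<^sub>m m $$ (i, j)" if "i < m" "j < m" for i j
      using D that "0.prems"(4)[of i j] by (cases i j rule: linorder_cases) auto
    hence "g = 1\<^sub>m m" using D(1) by (intro eq_matI) auto
    thus ?case using one by simp
  next
    case (Suc r)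
    note D = unitriangularD[OF Suc.prems(2)]
    define i j where "i = N div m" and "j = N mod m"
    have N: "N = i * m + j" by (simp add: i_def j_def)
    have pos: "i' = i \<and> j' = j" if "i' * m + j' = N" "j' < m" for i' j'
      using that by (auto simp: i_def j_def)
    show ?case
    proof (cases "i + w \<le> j \<and> j < m")
      case False
      have "g $$ (i', j') = 0" if ij: "i' < j'" "j' < m" "i' * m + j' < Suc N" for i' j'
      proof (cases "i' * m + j' = N")
        case True
        hence "i' = i" "j' = j" using pos ij by auto
        thus ?thesis using Suc.prems(3)[of i' j'] ij False by simp
      qed (use ij Suc.prems(4) in auto)
      thus ?thesis using Suc.IH[of "Suc N" g] Suc.prems by simp
    next
      case True
      define s where "s = - g $$ (i, j)"
      have ij: "i < j" "j < m" "i < m" using True w by auto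
      have entry: "addrow s i j g $$ (a, b) = (if i = a then s * g $$ (j, b) + g $$ (a, b) else g $$ (a, b))"
        if "a < m" "b < m" for a b using that D(1) by simp
      \<comment> \<open>Row \<open>j\<close> vanishes to the left of its diagonal entry, so adding
        it to row \<open>i\<close> disturbs neither the entries cleared earlier nor the zero
        band.\<close>
      have low: "addrow s i j g $$ (a, b) = g $$ (a, b)" if "a < m" "b < j" for a b
        using that ij D(2)[of b j] by (simp add: entry)
      have g': "addrow s i j g \<in> unitriangular_mats m"
        unfolding unitriangular_iff using D ij by (auto simp: entry simp del: index_mat_addrow)
      have "addrow s i j g $$ (a, b) = 0" if "a < b" "b < a + w" "b < m" for a b
        using that ij True low[of a b] Suc.prems(3)[of a b] by (cases "a = i") (auto simp: entry simp del: index_mat_addrow)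
      moreover have "addrow s i j g $$ (a, b) = 0" if ab: "a < b" "b < m" "a * m + b < Suc N" for a b
      proof (cases "a * m + b = N")
        case True
        hence "a = i" "b = j" using pos ab by auto
        thus ?thesis using entry[of i j] ij D(3)[of j] unfolding s_def by (simp del: index_mat_addrow)
      next
        case False
        hence "a * m + b < N" using ab by simp
        hence "g $$ (a, b) = 0" using Suc.prems(4) ab by simp
        moreover have "b < j" if "a = i" using that \<open>a * m + b < N\<close> by (simp add: N)
        ultimately show ?thesis using low[of a b] ab by (cases "a = i") (auto simp: entry simp del: index_mat_addrow)
      qed
      ultimately have "Q (addrow s i j g)"
        using Suc.IH[of "Suc N" "addrow s i j g"] Suc.prems(1) g' by simp
      thus ?thesis using addrow[of i j g s] True Suc.prems(2) by simp
    qed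
  qed
  from this[of 0 "m * m" g] g band show ?thesis by simp
qed

lemma group_unitriangular: "group (unitriangular_group TYPE('a::field) m)"
proof (rule groupI, unfold unitriangular_group_simps)
  fix x y z :: "'a mat"
  assume "x \<in> unitriangular_mats m" "y \<in> unitriangular_mats m" "z \<in> unitriangular_mats m"
  thus "x * y * z = x * (y * z)"
    by (intro assoc_mult_mat[of _ m m _ m _ m]) (auto dest: unitriangularD(1))
next
  fix x :: "'a mat" assume x: "x \<in> unitriangular_mats m"
  \<comment> \<open>Width 1 is the empty band, so the induction applies to every unitriangular
    matrix.\<close>
  have no_band: "\<forall>i j. i < j \<longrightarrow> j < i + Suc 0 \<longrightarrow> j < m \<longrightarrow> x $$ (i, j) = 0" by simp
  have "\<exists>y\<in>unitriangular_mats m. y * x = 1\<^sub>m m"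
    using zero_less_Suc[of 0] x no_band
  proof (induction rule: unitriangular_induct)
    case (addrow i j s g)
    then obtain y where y: "y \<in> unitriangular_mats m" "y * addrow s i j g = 1\<^sub>m m" by blast
    note D = unitriangularD(1)[OF y(1)] unitriangularD(1)[OF addrow(3)]
    have "y * addrow_mat m s i j * g = y * (addrow_mat m s i j * g)"
      using D by (intro assoc_mult_mat[of _ m m _ m _ m]) auto
    also have "\<dots> = 1\<^sub>m m" using y D addrow_mat[of g m m j s i] addrow by simp
    finally have "y * addrow_mat m s i j * g = 1\<^sub>m m" .
    moreover have "y * addrow_mat m s i j \<in> unitriangular_mats m"
      using y addrow by (intro mult_unitriangular) auto
    ultimately show ?case by blast
  qed (auto intro: bexI[of _ "1\<^sub>m m"])
  thus "\<exists>y\<in>unitriangular_mats m. y * x = 1\<^sub>m m" .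
qed (auto simp: mult_unitriangular dest: unitriangularD(1))

lemma finite_unitriangular [simp]: "finite (unitriangular_mats m :: 'a::{field,finite} mat set)"
proof -
  have "unitriangular_mats m \<subseteq> (mat m m :: _ \<Rightarrow> 'a mat) ` (\<Pi>\<^sub>E ij\<in>{..<m}\<times>{..<m}. UNIV)"
  proof
    fix g :: "'a mat" assume "g \<in> unitriangular_mats m"
    thus "g \<in> mat m m ` (\<Pi>\<^sub>E ij\<in>{..<m}\<times>{..<m}. UNIV)"
      by (intro image_eqI[where x = "restrict (($$) g) ({..<m}\<times>{..<m})"])
        (auto dest!: unitriangularD(1))
  qed
  thus ?thesis by (rule finite_subset) (simp add: finite_PiE)
qed

section \<open>Coordinates on the first two superdiagonals\<close>

definition superdiag :: "nat \<Rightarrow> 'a mat \<Rightarrow> 'a vec" where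
  "superdiag k g = vec (Suc k) (\<lambda>i. g $$ (i, Suc i))"

text \<open>Matrices of size \<open>k + 2\<close> have \<open>k + 1\<close> entries on the first
  superdiagonal and \<open>k\<close> on the second: the vertices and the edges of the path
  underlying \<open>path_form\<close>.\<close>

definition superdiag2 :: "nat \<Rightarrow> 'a mat \<Rightarrow> 'a vec" where
  "superdiag2 k g = vec k (\<lambda>i. g $$ (i, Suc (Suc i)))"

lemma superdiag_carrier [simp]:
  "superdiag k g \<in> carrier_vec (Suc k)" "superdiag2 k g \<in> carrier_vec k"
  by (simp_all add: superdiag_def superdiag2_def)

lemma dim_superdiag [simp]: "dim_vec (superdiag k g) = Suc k" "dim_vec (superdiag2 k g) = k"
  by (simp_all add: superdiag_def superdiag2_def)

lemma superdiag_mult: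
  assumes "g \<in> unitriangular_mats (Suc (Suc k))" "h \<in> unitriangular_mats (Suc (Suc k))"
  shows "superdiag k (g * h) = superdiag k g + superdiag k h"
  using assms unitriangularD[OF assms(1)] unitriangularD[OF assms(2)]
  by (intro eq_vecI)
    (auto simp: superdiag_def unitriangular_mult_entry atLeastAtMostSuc_conv add.commute simp del: index_mult_mat)

text \<open>The middle term is the only noncommutativity that a Heisenberg character can detect;
  pairing it with \<open>c\<close> gives \<open>path_form\<close>.\<close>

lemma superdiag2_mult:
  assumes "g \<in> unitriangular_mats (Suc (Suc k))" "h \<in> unitriangular_mats (Suc (Suc k))"
  shows "superdiag2 k (g * h) = superdiag2 k g +
    vec k (\<lambda>i. superdiag k g $ i * superdiag k h $ Suc i) + superdiag2 k h"
  using assms unitriangularD[OF assms(1)] unitriangularD[OF assms(2)]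
  by (intro eq_vecI)
    (auto simp: superdiag_def superdiag2_def unitriangular_mult_entry atLeastAtMostSuc_conv add_ac
      simp del: index_mult_mat)

lemma superdiag_one [simp]: "superdiag k (1\<^sub>m (Suc (Suc k))) = 0\<^sub>v (Suc k)"
  "superdiag2 k (1\<^sub>m (Suc (Suc k))) = 0\<^sub>v k"
  by (auto simp: superdiag_def superdiag2_def)

lemma superdiag_surj:
  assumes "a \<in> carrier_vec (Suc k)" "b \<in> carrier_vec k"
  obtains g where "g \<in> unitriangular_mats (Suc (Suc k))" "superdiag k g = a" "superdiag2 k g = b"
proof
  let ?g = "mat (Suc (Suc k)) (Suc (Suc k)) (\<lambda>(i, j).
    if j = i then 1 else if j = Suc i then a $ i else if j = Suc (Suc i) then b $ i else 0)"
  show "?g \<in> unitriangular_mats (Suc (Suc k))" by (auto simp: unitriangular_iff)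
  show "superdiag k ?g = a" "superdiag2 k ?g = b"
    using assms by (auto simp: superdiag_def superdiag2_def)
qed

definition superdiag_kernel :: "nat \<Rightarrow> 'a::field mat set" where
  "superdiag_kernel k = {g \<in> unitriangular_mats (Suc (Suc k)). superdiag k g = 0\<^sub>v (Suc k) \<and> superdiag2 k g = 0\<^sub>v k}"

text \<open>The commutator relation of elementary matrices, with the inverses moved to the other
  side so that it becomes an identity between row operations.\<close>

lemma addrow_mat_commutator:
  fixes s :: "'a::field"
  assumes "i < p" "p < j" "j < m"
  shows "addrow_mat m s i p * addrow_mat m t p j =
    addrow_mat m (s * t) i j * (addrow_mat m t p j * addrow_mat m s i p)"
proof -
  have "addrow_mat m s i p * addrow_mat m t p j = addrow s i p (addrow_mat m t p j)"
    using assms by (intro addrow_mat[symmetric, of _ _ m]) auto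
  also have "\<dots> = addrow (s * t) i j (addrow t p j (addrow_mat m s i p))"
    using assms by (intro eq_matI) (auto simp: addrow_mat_def mat_addrow_gen_def)
  also have "\<dots> = addrow_mat m (s * t) i j * addrow t p j (addrow_mat m s i p)"
    using assms by (intro addrow_mat[of _ _ m]) (auto simp: mat_addrow_gen_def)
  also have "addrow t p j (addrow_mat m s i p) = addrow_mat m t p j * addrow_mat m s i p"
    using assms by (intro addrow_mat[of _ _ m]) auto
  finally show ?thesis .
qed

lemma (in group) commutator_eqI:
  assumes "x \<in> carrier G" "y \<in> carrier G" "z \<in> carrier G" "x \<otimes> y = z \<otimes> (y \<otimes> x)"
  shows "z = x \<otimes> y \<otimes> inv x \<otimes> inv y"
proof -
  have "x \<otimes> y \<otimes> inv x \<otimes> inv y = z \<otimes> (y \<otimes> x) \<otimes> inv x \<otimes> inv y" by (simp add: assms(4))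
  also have "\<dots> = z \<otimes> (y \<otimes> (x \<otimes> inv x) \<otimes> inv y)"
    using assms(1-3) by (simp add: m_assoc del: r_inv)
  also have "\<dots> = z" using assms(1-3) by simp
  finally show ?thesis ..
qed

section \<open>The third term of the lower central series\<close>

locale unitriangular =
  fixes k :: nat and G :: "'a::{field,finite} mat monoid"
  defines G: "G \<equiv> unitriangular_group TYPE('a) (Suc (Suc k))"
begin

sublocale group G unfolding G by (rule group_unitriangular)

lemma G_simps [simp]: "x \<otimes>\<^bsub>G\<^esub> y = x * y" "\<one>\<^bsub>G\<^esub> = 1\<^sub>m (Suc (Suc k))"
  by (simp_all add: G)

lemma finite_carrier [simp, intro]: "finite (carrier G)"
  by (simp add: G)

lemmas superdiag_G = superdiag_mult[where ?'a = 'a, of _ k, folded G]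
  superdiag2_mult[where ?'a = 'a, of _ k, folded G]

lemma mult_closed: "g \<in> carrier G \<Longrightarrow> h \<in> carrier G \<Longrightarrow> g * h \<in> carrier G"
  using m_closed by simp

lemma superdiag_inv:
  assumes "g \<in> carrier G"
  shows "superdiag k (inv\<^bsub>G\<^esub> g) = - superdiag k g"
proof -
  have "superdiag k (inv\<^bsub>G\<^esub> g) + superdiag k g = 0\<^sub>v (Suc k)"
    using superdiag_G(1)[of "inv\<^bsub>G\<^esub> g" g] l_inv[OF assms] assms by simp
  hence "(superdiag k (inv\<^bsub>G\<^esub> g) + superdiag k g) $ i = 0" if "i < Suc k" for i using that by simp
  thus ?thesis by (intro eq_vecI) (auto simp: eq_neg_iff_add_eq_0)
qed

lemma superdiag_conj:
  assumes g: "g \<in> carrier G" and z: "z \<in> carrier G" "superdiag k z = 0\<^sub>v (Suc k)"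
  shows "superdiag k (g * z * inv\<^bsub>G\<^esub> g) = 0\<^sub>v (Suc k)" "superdiag2 k (g * z * inv\<^bsub>G\<^esub> g) = superdiag2 k z"
proof -
  let ?c = "g * z * inv\<^bsub>G\<^esub> g"
  have c: "?c \<in> carrier G" using g z by (intro mult_closed) auto
  \<comment> \<open>Comparing second superdiagonals on both sides of this equation avoids a formula
    for the second superdiagonal of an inverse.\<close>
  have cg: "?c * g = g * z" using m_assoc[of "g * z" "inv\<^bsub>G\<^esub> g" g] g z l_inv[OF g] mult_closed r_one[of "g * z"] by simp
  show 1: "superdiag k ?c = 0\<^sub>v (Suc k)"
    using g z by (auto simp: superdiag_G mult_closed superdiag_inv intro!: eq_vecI)
  have "superdiag2 k ?c $ i = superdiag2 k z $ i" if "i < k" for i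
  proof -
    have "superdiag2 k (?c * g) $ i = superdiag2 k ?c $ i + superdiag2 k g $ i"
      using superdiag_G(2)[OF c g] 1 that by simp
    moreover have "superdiag2 k (g * z) $ i = superdiag2 k g $ i + superdiag2 k z $ i"
      using superdiag_G(2)[OF g z(1)] z(2) that by simp
    ultimately show ?thesis by (simp add: cg)
  qed
  thus "superdiag2 k ?c = superdiag2 k z" by (intro eq_vecI) auto
qed

lemma subgroup_center_preimage: "subgroup {g \<in> carrier G. superdiag k g = 0\<^sub>v (Suc k)} G"
  by (rule subgroupI) (auto simp: superdiag_G superdiag_inv mult_closed intro: exI[of _ "1\<^sub>m (Suc (Suc k))"])

lemma superdiag_kernel_G:
  "superdiag_kernel k = {g \<in> carrier G. superdiag k g = 0\<^sub>v (Suc k) \<and> superdiag2 k g = 0\<^sub>v k}"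
  by (simp add: superdiag_kernel_def G)

lemma superdiag2_inv_kernel:
  assumes "g \<in> superdiag_kernel k"
  shows "superdiag2 k (inv\<^bsub>G\<^esub> g) = 0\<^sub>v k"
proof -
  have g: "g \<in> carrier G" "superdiag k g = 0\<^sub>v (Suc k)" "superdiag2 k g = 0\<^sub>v k"
    using assms by (auto simp: superdiag_kernel_G)
  have "superdiag2 k (inv\<^bsub>G\<^esub> g * g) = 0\<^sub>v k" using l_inv[OF g(1)] by simp
  moreover have "superdiag2 k (inv\<^bsub>G\<^esub> g * g) = superdiag2 k (inv\<^bsub>G\<^esub> g)"
    using g by (auto simp: superdiag_G intro!: eq_vecI)
  ultimately show ?thesis by simp
qed

lemma subgroup_superdiag_kernel: "subgroup (superdiag_kernel k) G"
proof (rule subgroupI)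
  have "1\<^sub>m (Suc (Suc k)) \<in> (superdiag_kernel k :: 'a mat set)" using one_closed by (simp add: superdiag_kernel_G)
  thus "(superdiag_kernel k :: 'a mat set) \<noteq> {}" by blast
  fix g h :: "'a mat" assume gh: "g \<in> superdiag_kernel k" "h \<in> superdiag_kernel k"
  thus "g \<otimes>\<^bsub>G\<^esub> h \<in> superdiag_kernel k"
    by (auto simp: superdiag_kernel_G superdiag_G mult_closed intro!: eq_vecI)
  show "inv\<^bsub>G\<^esub> g \<in> superdiag_kernel k"
    using gh superdiag2_inv_kernel[of g] by (auto simp: superdiag_kernel_G superdiag_inv)
qed (auto simp: superdiag_kernel_G)

lemma superdiag_kernel_normal:
  assumes "g \<in> carrier G" "z \<in> superdiag_kernel k"
  shows "g \<otimes>\<^bsub>G\<^esub> z \<otimes>\<^bsub>G\<^esub> inv\<^bsub>G\<^esub> g \<in> superdiag_kernel k"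
  using assms superdiag_conj[of g z] by (auto simp: superdiag_kernel_G mult_closed)

text \<open>The first superdiagonal is additive, so it vanishes on derived elements, which are
  therefore central modulo \<open>superdiag_kernel\<close>; this gives one inclusion. Conversely, an
  elementary matrix at \<open>(i, j)\<close> with \<open>i + 3 \<le> j\<close> is a commutator of
  elementary matrices at \<open>(i, i + 1)\<close> and \<open>(i + 1, j)\<close>, the latter itself
  a commutator, and elimination with band width 3 reduces the kernel to such matrices.\<close>

theorem commutator_subgroup_eq:
  "commutator_subgroup G (carrier G) (derived G (carrier G)) = superdiag_kernel k"
proof
  let ?Z = "{g \<in> carrier G. superdiag k g = 0\<^sub>v (Suc k)}"
  have "derived G (carrier G) \<subseteq> ?Z"
    unfolding derived_def
    by (rule generate_subgroup_incl[OF _ subgroup_center_preimage])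
      (auto simp: superdiag_G superdiag_inv mult_closed intro!: eq_vecI)
  moreover have "h * z * inv\<^bsub>G\<^esub> h * inv\<^bsub>G\<^esub> z \<in> superdiag_kernel k"
    if h: "h \<in> carrier G" and z: "z \<in> ?Z" for h z
  proof -
    let ?c = "h * z * inv\<^bsub>G\<^esub> h"
    have z': "z \<in> carrier G" "superdiag k z = 0\<^sub>v (Suc k)" using z by auto
    have c: "?c \<in> carrier G" "superdiag k ?c = 0\<^sub>v (Suc k)" "superdiag2 k ?c = superdiag2 k z"
      using superdiag_conj[OF h z'] h z' by (auto intro!: mult_closed)
    have "superdiag2 k (inv\<^bsub>G\<^esub> z * z) = superdiag2 k (inv\<^bsub>G\<^esub> z) + superdiag2 k z"
      using z' by (auto simp: superdiag_G superdiag_inv intro!: eq_vecI)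
    hence "superdiag2 k z + superdiag2 k (inv\<^bsub>G\<^esub> z) = 0\<^sub>v k"
      using l_inv[OF z'(1)] by (simp add: comm_add_vec[of _ k])
    moreover have "superdiag2 k (?c * inv\<^bsub>G\<^esub> z) = superdiag2 k z + superdiag2 k (inv\<^bsub>G\<^esub> z)"
      using z' c by (auto simp: superdiag_G(2) superdiag_inv intro!: eq_vecI)
    moreover have "superdiag k (?c * inv\<^bsub>G\<^esub> z) = 0\<^sub>v (Suc k)"
      using z' c by (auto simp: superdiag_G(1) superdiag_inv intro!: eq_vecI)
    ultimately show ?thesis using z' c by (auto simp: superdiag_kernel_G intro!: mult_closed)
  qed
  ultimately show "commutator_subgroup G (carrier G) (derived G (carrier G)) \<subseteq> superdiag_kernel k"
    unfolding commutator_subgroup_def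
    by (intro generate_subgroup_incl[OF _ subgroup_superdiag_kernel]) auto
next
  let ?m = "Suc (Suc k)"
  let ?C = "commutator_subgroup G (carrier G) (derived G (carrier G))"
  have T: "addrow_mat ?m s i j \<in> carrier G" if "i < j" "j < ?m" for i j and s :: 'a
    using that by (simp add: G)
  have comm: "addrow_mat ?m s i j =
      addrow_mat ?m s i p \<otimes>\<^bsub>G\<^esub> addrow_mat ?m 1 p j \<otimes>\<^bsub>G\<^esub> inv\<^bsub>G\<^esub> addrow_mat ?m s i p \<otimes>\<^bsub>G\<^esub> inv\<^bsub>G\<^esub> addrow_mat ?m 1 p j"
    if "i < p" "p < j" "j < ?m" for i p j and s :: 'a
    using that addrow_mat_commutator[of i p j ?m s 1] by (intro commutator_eqI T) auto
  have der: "addrow_mat ?m 1 i j \<in> derived G (carrier G)" if "Suc i < j" "j < ?m" for i j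
  proof -
    have "addrow_mat ?m 1 i j \<in> {addrow_mat ?m 1 i (Suc i) \<otimes>\<^bsub>G\<^esub> addrow_mat ?m 1 (Suc i) j \<otimes>\<^bsub>G\<^esub>
        inv\<^bsub>G\<^esub> addrow_mat ?m 1 i (Suc i) \<otimes>\<^bsub>G\<^esub> inv\<^bsub>G\<^esub> addrow_mat ?m 1 (Suc i) j}"
      by (rule iffD2[OF singleton_iff comm]) (use that in auto)
    thus ?thesis unfolding derived_def
      by (intro generate.incl UN_I[OF T[of i "Suc i" 1]] UN_I[OF T[of "Suc i" j 1]]) (use that in auto)
  qed
  have TC: "addrow_mat ?m s i j \<in> ?C" if "i + 3 \<le> j" "j < ?m" for i j s
  proof -
    have "addrow_mat ?m s i j \<in> {addrow_mat ?m s i (Suc i) \<otimes>\<^bsub>G\<^esub> addrow_mat ?m 1 (Suc i) j \<otimes>\<^bsub>G\<^esub>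
        inv\<^bsub>G\<^esub> addrow_mat ?m s i (Suc i) \<otimes>\<^bsub>G\<^esub> inv\<^bsub>G\<^esub> addrow_mat ?m 1 (Suc i) j}"
      by (rule iffD2[OF singleton_iff comm]) (use that in auto)
    thus ?thesis unfolding commutator_subgroup_def
      by (intro generate.incl UN_I[OF T[of i "Suc i" s]] UN_I[OF der[of "Suc i" j]]) (use that in auto)
  qed
  have "derived G (carrier G) \<subseteq> carrier G" by (rule derived_in_carrier) simp
  hence sub: "subgroup ?C G"
    unfolding commutator_subgroup_def
    by (intro generate_is_subgroup) (auto simp: subset_iff intro!: mult_closed)
  show "superdiag_kernel k \<subseteq> ?C"
  proof
    fix g :: "'a mat" assume g: "g \<in> superdiag_kernel k"
    have g': "g \<in> unitriangular_mats ?m" using g by (simp add: superdiag_kernel_def)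
    have band: "g $$ (i, j) = 0" if "i < j" "j < i + 3" "j < ?m" for i j
    proof -
      have "superdiag k g $ i = 0" "j = Suc (Suc i) \<Longrightarrow> superdiag2 k g $ i = 0"
        using g that by (auto simp: superdiag_kernel_def)
      moreover have "j = Suc i \<or> j = Suc (Suc i)" using that by auto
      ultimately show ?thesis using that by (auto simp: superdiag_def superdiag2_def)
    qed
    hence band': "\<forall>i j. i < j \<longrightarrow> j < i + 3 \<longrightarrow> j < ?m \<longrightarrow> g $$ (i, j) = 0" by blast
    have "(0::nat) < 3" by simp
    from this g' band' show "g \<in> ?C"
    proof (induction rule: unitriangular_induct)
      case one
      show ?case using subgroup.one_closed[OF sub] by simp
    next
      case (addrow i j s g)
      let ?T = "addrow_mat ?m s i j"
      have g: "g \<in> carrier G" using addrow by (simp add: G)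
      have TC': "?T \<in> ?C" and TG: "?T \<in> carrier G" using addrow TC T by auto
      have "?T * g \<in> ?C"
        using addrow addrow_mat[of g ?m ?m j s i] unitriangularD(1)[OF addrow(3)] by simp
      hence "inv\<^bsub>G\<^esub> ?T \<otimes>\<^bsub>G\<^esub> (?T \<otimes>\<^bsub>G\<^esub> g) \<in> ?C"
        using subgroup.m_closed[OF sub] subgroup.m_inv_closed[OF sub TC'] by simp
      also have "inv\<^bsub>G\<^esub> ?T \<otimes>\<^bsub>G\<^esub> (?T \<otimes>\<^bsub>G\<^esub> g) = g"
        using TG g l_inv[OF TG] l_one[OF g] by (metis inv_closed m_assoc)
      finally show ?case .
    qed
  qed
qed

end

section \<open>Heisenberg characters\<close>

lemma mat_trace_mult_commute:
  fixes A B :: "'a::comm_semiring_0 mat"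
  assumes A: "A \<in> carrier_mat d d" and B: "B \<in> carrier_mat d d"
  shows "mat_trace (A * B) = mat_trace (B * A)"
proof -
  have "mat_trace (A * B) = (\<Sum>i<d. \<Sum>p<d. A $$ (i, p) * B $$ (p, i))"
    using A B by (simp add: mat_trace_carrier[of _ d] mult_mat_entry[OF A B] del: index_mult_mat)
  also have "\<dots> = (\<Sum>i<d. \<Sum>p<d. B $$ (i, p) * A $$ (p, i))"
    by (subst sum.swap) (simp add: mult.commute)
  also have "\<dots> = mat_trace (B * A)"
    using A B by (simp add: mat_trace_carrier[of _ d] mult_mat_entry[OF B A] del: index_mult_mat)
  finally show ?thesis .
qed

lemma mat_trace_smult:
  fixes A :: "'a::semiring_0 mat"
  shows "A \<in> carrier_mat d d \<Longrightarrow> mat_trace (x \<cdot>\<^sub>m A) = x * mat_trace A"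
  by (simp add: mat_trace_def sum_distrib_left)

lemma smult_one_mat_eq_iff:
  "0 < d \<Longrightarrow> x \<cdot>\<^sub>m 1\<^sub>m d = y \<cdot>\<^sub>m (1\<^sub>m d :: 'a::semiring_1 mat) \<longleftrightarrow> x = y"
  by (auto simp: mat_eq_iff)

lemma smult_smult_mat: "x \<cdot>\<^sub>m (y \<cdot>\<^sub>m A) = (x * y :: 'a::semigroup_mult) \<cdot>\<^sub>m A"
  by (auto simp: mult.assoc)

lemma one_smult_mat [simp]: "(1 :: 'a::monoid_mult) \<cdot>\<^sub>m A = A"
  by auto

lemma smult_one_mat_mult:
  fixes x y :: "'a::comm_ring_1"
  shows "(x \<cdot>\<^sub>m 1\<^sub>m d) * (y \<cdot>\<^sub>m 1\<^sub>m d) = (x * y) \<cdot>\<^sub>m 1\<^sub>m d"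
  by (simp add: mult_smult_assoc_mat[of _ d d _ d] smult_smult_mat)

lemma additive_characters_iff:
  "\<psi> \<in> additive_characters TYPE('b::field) \<longleftrightarrow>
     (\<forall>x y. \<psi> (x + y) = \<psi> x * \<psi> y) \<and> (\<forall>x. \<psi> x \<noteq> 0)"
proof -
  have "Units (class_ring :: complex ring) = {x. x \<noteq> 0}"
    by (auto simp: Units_def) (metis left_inverse right_inverse)
  thus ?thesis
    by (auto simp: additive_characters_def hom_def units_of_carrier units_of_mult Pi_iff)
qed

section \<open>Classification of the Heisenberg characters\<close>

locale heisenberg = unitriangular k G + additive_character \<theta>
  for k :: nat and G :: "'a::{field,finite} mat monoid" and \<theta> :: "'a \<Rightarrow> complex"
begin

abbreviation sd :: "'a mat \<Rightarrow> 'a vec" where "sd \<equiv> superdiag k"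
abbreviation sd2 :: "'a mat \<Rightarrow> 'a vec" where "sd2 \<equiv> superdiag2 k"
abbreviation V :: "'a vec set" where "V \<equiv> carrier_vec (Suc k)"

definition radical_preimage :: "'a vec \<Rightarrow> 'a mat set" where
  "radical_preimage c = {g \<in> carrier G. sd g \<in> path_radical c}"

text \<open>The value forced by the norm relation: a character that vanishes off the radical
  preimage, and belongs to a representation by scalars on it, satisfies
  \<open>d * d * card (radical_preimage c) = card (carrier G)\<close>.\<close>

definition heis_degree :: "'a vec \<Rightarrow> complex" where
  "heis_degree c = of_real (sqrt (card (carrier G) / card (radical_preimage c)))"

text \<open>Only the values of \<open>\<theta> (y \<bullet> a)\<close> for \<open>a\<close> in the
  radical matter, so different \<open>y\<close> can give the same character.\<close>

definition heis_char :: "'a vec \<Rightarrow> 'a vec \<Rightarrow> 'a mat \<Rightarrow> complex" where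
  "heis_char c y = (\<lambda>g\<in>carrier G. if sd g \<in> path_radical c
     then heis_degree c * \<theta> (c \<bullet> sd2 g + y \<bullet> sd g) else 0)"

lemma scalar_prod_sd2_mult:
  assumes "c \<in> carrier_vec k" "g \<in> carrier G" "h \<in> carrier G"
  shows "c \<bullet> sd2 (g * h) = c \<bullet> sd2 g + path_form c (sd g) (sd h) + c \<bullet> sd2 h"
proof -
  have "c \<bullet> vec k (\<lambda>i. sd g $ i * sd h $ Suc i) = path_form c (sd g) (sd h)"
    using assms(1) by (simp add: scalar_prod_def path_form_def lessThan_atLeast0 mult.assoc)
  thus ?thesis using assms by (simp add: superdiag_G(2) scalar_prod_add_distrib[of _ k])
qed

lemma superdiag_G_surj:
  assumes "a \<in> V" "b \<in> carrier_vec k"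
  shows "\<exists>g\<in>carrier G. sd g = a \<and> sd2 g = b"
  using superdiag_surj[OF assms] unfolding G by metis

lemma zero_path_radical [simp]: "dim_vec c = k \<Longrightarrow> 0\<^sub>v (Suc k) \<in> path_radical c"
  using vec_subgroup_path_radical[of c] by (simp add: vec_subgroup_def)

lemma one_radical_preimage: "c \<in> carrier_vec k \<Longrightarrow> 1\<^sub>m (Suc (Suc k)) \<in> radical_preimage c"
  using one_closed by (simp add: radical_preimage_def)

lemma heis_degree_nonzero: "c \<in> carrier_vec k \<Longrightarrow> heis_degree c \<noteq> 0"
proof -
  assume c: "c \<in> carrier_vec k"
  have "radical_preimage c \<noteq> {}" using one_radical_preimage[OF c] by blast
  moreover have "finite (radical_preimage c)" by (simp add: radical_preimage_def)
  moreover have "carrier G \<noteq> {}" using one_closed by blast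
  ultimately show ?thesis by (simp add: heis_degree_def)
qed

lemma heis_char_center:
  assumes "c \<in> carrier_vec k" "y \<in> V" "g \<in> carrier G" "sd g = 0\<^sub>v (Suc k)"
  shows "heis_char c y g = heis_degree c * \<theta> (c \<bullet> sd2 g)"
  using assms by (simp add: heis_char_def)

lemma scalar_prod_character_eq:
  assumes "c \<in> carrier_vec n" "c' \<in> carrier_vec n" "\<And>b. b \<in> carrier_vec n \<Longrightarrow> \<theta> (c \<bullet> b) = \<theta> (c' \<bullet> b)"
  shows "c = c'"
proof -
  have "c - c' = 0\<^sub>v n"
    using assms by (intro scalar_prod_eq_0) (auto simp: minus_scalar_prod_distrib[of _ n] diff)
  thus ?thesis using assms(1,2) by (auto simp: vec_eq_iff)
qed

text \<open>Elements with zero first superdiagonal act by scalars, which defines \<open>c\<close>;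
  so do elements over the radical, which defines \<open>y\<close>. For any other element some
  conjugation multiplies the trace by a number different from 1, so the trace vanishes. The norm
  relation then fixes the degree.\<close>

theorem irreducible_rep_heis_char:
  assumes irr: "irreducible_rep G d \<rho>"
    and ker: "\<And>z. z \<in> superdiag_kernel k \<Longrightarrow> mat_trace (\<rho> z) = mat_trace (\<rho> \<one>\<^bsub>G\<^esub>)"
  obtains c y where "c \<in> carrier_vec k" "y \<in> V" "\<And>g. g \<in> carrier G \<Longrightarrow> mat_trace (\<rho> g) = heis_char c y g"
proof -
  have d: "d > 0" and one: "\<rho> (1\<^sub>m (Suc (Suc k))) = 1\<^sub>m d"
    and car: "\<And>g. g \<in> carrier G \<Longrightarrow> \<rho> g \<in> carrier_mat d d"
    and mult: "\<And>g h. g \<in> carrier G \<Longrightarrow> h \<in> carrier G \<Longrightarrow> \<rho> (g * h) = \<rho> g * \<rho> h"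
    using irreducible_repD[OF irr] by simp_all
  have triv: "\<rho> z = 1\<^sub>m d" if "z \<in> superdiag_kernel k" for z
    by (rule irreducible_rep_trivial_on_kernel[OF irr subgroup_superdiag_kernel _ superdiag_kernel_normal ker that])
      (simp_all add: superdiag_kernel_G)
  \<comment> \<open>The representation factors through the two superdiagonals, because the quotient
    \<open>z\<close> of two elements that agree there lies in the kernel.\<close>
  have dep: "\<rho> g = \<rho> h" if g: "g \<in> carrier G" and h: "h \<in> carrier G" and eq: "sd g = sd h" "sd2 g = sd2 h" for g h
  proof -
    define z where "z = inv\<^bsub>G\<^esub> h * g"
    have z: "z \<in> carrier G" using g h by (simp add: z_def mult_closed)
    have hz: "h * z = g" using m_assoc[of h "inv\<^bsub>G\<^esub> h" g] g h r_inv[OF h] l_one[OF g] by (simp add: z_def)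
    have sz: "sd z = 0\<^sub>v (Suc k)" using g h eq by (simp add: z_def superdiag_G superdiag_inv)
    have "sd2 z $ i = 0" if "i < k" for i
    proof -
      have "sd2 (h * z) $ i = sd2 h $ i + sd2 z $ i"
        using superdiag_G(2)[OF h z] sz that by simp
      thus ?thesis by (simp add: hz eq)
    qed
    hence "z \<in> superdiag_kernel k" using z sz by (auto simp: superdiag_kernel_G intro!: eq_vecI)
    hence "\<rho> (h * z) = \<rho> h" using mult[OF h z] triv car[OF h] by simp
    thus ?thesis by (simp add: hz)
  qed
  have comm_scalar: "\<exists>l. \<rho> g = l \<cdot>\<^sub>m 1\<^sub>m d"
    if g: "g \<in> carrier G" and comm: "\<And>h. h \<in> carrier G \<Longrightarrow> \<rho> h * \<rho> g = \<rho> g * \<rho> h" for g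
    using schur_lemma[OF irr car[OF g] comm] by blast
  \<comment> \<open>Lifts \<open>\<zeta> b\<close> of second superdiagonals; they are central modulo
    the kernel, hence scalar under \<open>\<rho>\<close>.\<close>
  have "\<exists>z. z \<in> carrier G \<and> sd z = 0\<^sub>v (Suc k) \<and> sd2 z = b" if "b \<in> carrier_vec k" for b
    using superdiag_G_surj[of "0\<^sub>v (Suc k)" b] that by auto
  then obtain \<zeta> where \<zeta>: "\<And>b. b \<in> carrier_vec k \<Longrightarrow> \<zeta> b \<in> carrier G"
      "\<And>b. b \<in> carrier_vec k \<Longrightarrow> sd (\<zeta> b) = 0\<^sub>v (Suc k)" "\<And>b. b \<in> carrier_vec k \<Longrightarrow> sd2 (\<zeta> b) = b"
    by metis
  have "\<exists>l. \<rho> (\<zeta> b) = l \<cdot>\<^sub>m 1\<^sub>m d" if b: "b \<in> carrier_vec k" for b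
  proof (rule comm_scalar)
    fix h assume h: "h \<in> carrier G"
    have "\<rho> (h * \<zeta> b) = \<rho> (\<zeta> b * h)"
      using h \<zeta>[OF b] carrier_vecD[OF b] by (intro dep mult_closed) (auto simp: superdiag_G intro!: eq_vecI)
    thus "\<rho> h * \<rho> (\<zeta> b) = \<rho> (\<zeta> b) * \<rho> h" using h \<zeta>[OF b] by (simp add: mult)
  qed (use \<zeta> b in blast)
  then obtain l where l: "\<And>b. b \<in> carrier_vec k \<Longrightarrow> \<rho> (\<zeta> b) = l b \<cdot>\<^sub>m 1\<^sub>m d" by metis
  have "l (a + b) = l a * l b" if a: "a \<in> carrier_vec k" and b: "b \<in> carrier_vec k" for a b
  proof -
    have ab: "a + b \<in> carrier_vec k" using a b by simp
    have "\<rho> (\<zeta> (a + b)) = \<rho> (\<zeta> a * \<zeta> b)"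
      using a b \<zeta>[OF a] \<zeta>[OF b] \<zeta>[OF ab] carrier_vecD[OF a] carrier_vecD[OF b] by (intro dep mult_closed) (auto simp: superdiag_G intro!: eq_vecI)
    thus ?thesis using \<zeta>[OF a] \<zeta>[OF b] l[OF a] l[OF b] l[OF ab] d
      by (simp add: mult smult_one_mat_mult smult_one_mat_eq_iff)
  qed
  moreover have "l (0\<^sub>v k) = 1"
  proof -
    have "\<rho> (\<zeta> (0\<^sub>v k)) = \<rho> (1\<^sub>m (Suc (Suc k)))"
      using \<zeta>[of "0\<^sub>v k"] one_closed by (intro dep) auto
    hence "l (0\<^sub>v k) \<cdot>\<^sub>m 1\<^sub>m d = 1 \<cdot>\<^sub>m 1\<^sub>m d" using l[of "0\<^sub>v k"] one by simp
    thus ?thesis using d smult_one_mat_eq_iff by blast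
  qed
  ultimately have "\<exists>c\<in>carrier_vec k. \<forall>b\<in>carrier_vec k. l b = \<theta> (c \<bullet> b)"
    by (rule vec_subgroup_character_extends[OF vec_subgroup_carrier_vec])
  then obtain c where c: "c \<in> carrier_vec k" and lc: "\<And>b. b \<in> carrier_vec k \<Longrightarrow> l b = \<theta> (c \<bullet> b)"
    by blast
  have dc [simp]: "dim_vec c = k" using c by simp
  have center_mult: "\<rho> (\<zeta> b * g) = \<theta> (c \<bullet> b) \<cdot>\<^sub>m \<rho> g" if "b \<in> carrier_vec k" "g \<in> carrier G" for b g
    using that \<zeta>[of b] car[of g] l[of b] lc[of b] by (simp add: mult mult_smult_assoc_mat[of _ d d _ d])
  have comm: "\<rho> (g * h) = \<theta> (path_form c (sd g) (sd h) - path_form c (sd h) (sd g)) \<cdot>\<^sub>m \<rho> (h * g)"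
    if g: "g \<in> carrier G" and h: "h \<in> carrier G" for g h
  proof -
    \<comment> \<open>The second superdiagonal of the commutator of \<open>g\<close> and
      \<open>h\<close>.\<close>
    define b where "b = vec k (\<lambda>i. sd g $ i * sd h $ Suc i - sd h $ i * sd g $ Suc i)"
    have b: "b \<in> carrier_vec k" by (simp add: b_def)
    have hg: "h * g \<in> carrier G" "g * h \<in> carrier G" using g h by (auto intro: mult_closed)
    have "sd (\<zeta> b * (h * g)) = sd (g * h)"
      using g h hg \<zeta>[OF b] by (auto simp: superdiag_G(1) intro!: eq_vecI)
    moreover have "sd2 (\<zeta> b * (h * g)) = sd2 (g * h)"
      using g h \<zeta>[OF b] superdiag_G(2)[OF \<zeta>(1)[OF b] hg(1)] superdiag_G(2)[OF g h] superdiag_G(2)[OF h g]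
      by (auto simp: b_def intro!: eq_vecI)
    ultimately have "\<rho> (g * h) = \<rho> (\<zeta> b * (h * g))"
      using hg \<zeta>[OF b] by (intro dep) (auto intro: mult_closed)
    also have "\<dots> = \<theta> (c \<bullet> b) \<cdot>\<^sub>m \<rho> (h * g)" by (rule center_mult[OF b hg(1)])
    also have "c \<bullet> b = path_form c (sd g) (sd h) - path_form c (sd h) (sd g)"
      by (simp add: b_def scalar_prod_def path_form_def lessThan_atLeast0 algebra_simps sum_subtractf)
    finally show ?thesis .
  qed
  have tr0: "mat_trace (\<rho> g) = 0" if g: "g \<in> carrier G" and nr: "sd g \<notin> path_radical c" for g
  proof -
    obtain v where v: "v \<in> V" "\<theta> (path_form c (sd g) v - path_form c v (sd g)) \<noteq> 1"
      using nr path_radical_iff[of "sd g" c] by auto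
    obtain h where h: "h \<in> carrier G" "sd h = v"
      using superdiag_G_surj[OF v(1), of "0\<^sub>v k"] by auto
    let ?t = "\<theta> (path_form c (sd g) v - path_form c v (sd g))"
    have hg: "h * g \<in> carrier G" "g * h \<in> carrier G" "inv\<^bsub>G\<^esub> h \<in> carrier G"
      using g h by (auto intro: mult_closed)
    \<comment> \<open>Conjugation by \<open>h\<close> preserves the trace, yet by the commutation
      relation it also produces the factor \<open>?t\<close>, which is not 1.\<close>
    have "\<rho> g = \<rho> (g * h * inv\<^bsub>G\<^esub> h)"
      using m_assoc[of g h "inv\<^bsub>G\<^esub> h"] r_inv[OF h(1)] r_one[OF g] g h by simp
    also have "\<dots> = (?t \<cdot>\<^sub>m \<rho> (h * g)) * \<rho> (inv\<^bsub>G\<^esub> h)"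
      using mult[OF hg(2,3)] comm[OF g h(1)] h(2) by simp
    also have "\<dots> = ?t \<cdot>\<^sub>m (\<rho> (h * g) * \<rho> (inv\<^bsub>G\<^esub> h))"
      using car hg by (intro mult_smult_assoc_mat[of _ d d _ d]) auto
    finally have "mat_trace (\<rho> g) = ?t * mat_trace (\<rho> (h * g) * \<rho> (inv\<^bsub>G\<^esub> h))"
      using mat_trace_smult[OF mult_carrier_mat[OF car[OF hg(1)] car[OF hg(3)]], of ?t] by simp
    also have "mat_trace (\<rho> (h * g) * \<rho> (inv\<^bsub>G\<^esub> h)) = mat_trace (\<rho> (inv\<^bsub>G\<^esub> h) * \<rho> (h * g))"
      using car hg by (intro mat_trace_mult_commute[of _ d]) auto
    also have "\<rho> (inv\<^bsub>G\<^esub> h) * \<rho> (h * g) = \<rho> (inv\<^bsub>G\<^esub> h * (h * g))" using mult[OF hg(3,1)] by simp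
    also have "inv\<^bsub>G\<^esub> h * (h * g) = g"
      using m_assoc[of "inv\<^bsub>G\<^esub> h" h g] l_inv[OF h(1)] l_one[OF g] g h by simp
    finally show ?thesis using v(2) by simp
  qed
  have sub: "vec_subgroup (Suc k) (path_radical c)" using vec_subgroup_path_radical[of c] by simp
  hence radV: "a \<in> V" if "a \<in> path_radical c" for a using that by (auto simp: vec_subgroup_def)
  have "\<exists>g. g \<in> carrier G \<and> sd g = a \<and> sd2 g = 0\<^sub>v k" if "a \<in> V" for a
    using superdiag_G_surj[of a "0\<^sub>v k"] that by auto
  then obtain \<gamma> where \<gamma>: "\<And>a. a \<in> V \<Longrightarrow> \<gamma> a \<in> carrier G" "\<And>a. a \<in> V \<Longrightarrow> sd (\<gamma> a) = a"
      "\<And>a. a \<in> V \<Longrightarrow> sd2 (\<gamma> a) = 0\<^sub>v k"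
    by metis
  \<comment> \<open>Over the radical the commutation factor is 1, so
    \<open>\<rho> (\<gamma> a)\<close> commutes with everything and Schur's lemma applies.\<close>
  have "\<exists>x. \<rho> (\<gamma> a) = x \<cdot>\<^sub>m 1\<^sub>m d" if a: "a \<in> path_radical c" for a
  proof (rule comm_scalar)
    fix h assume h: "h \<in> carrier G"
    have "path_form c (sd h) (sd (\<gamma> a)) = path_form c (sd (\<gamma> a)) (sd h)"
      using path_radical_symmetric[OF a, of "sd h"] \<gamma>(2)[OF radV[OF a]] by simp
    hence "\<rho> (h * \<gamma> a) = 1 \<cdot>\<^sub>m \<rho> (\<gamma> a * h)" using comm[OF h \<gamma>(1)[OF radV[OF a]]] by simp
    also have "\<dots> = \<rho> (\<gamma> a * h)" by (intro eq_matI) auto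
    finally show "\<rho> h * \<rho> (\<gamma> a) = \<rho> (\<gamma> a) * \<rho> h" using h \<gamma>(1)[OF radV[OF a]] by (simp add: mult)
  qed (use \<gamma> radV[OF a] in blast)
  then obtain \<nu> where \<nu>: "\<And>a. a \<in> path_radical c \<Longrightarrow> \<rho> (\<gamma> a) = \<nu> a \<cdot>\<^sub>m 1\<^sub>m d" by metis
  have rad_scalar: "\<rho> g = (\<theta> (c \<bullet> sd2 g) * \<nu> (sd g)) \<cdot>\<^sub>m 1\<^sub>m d"
    if g: "g \<in> carrier G" and r: "sd g \<in> path_radical c" for g
  proof -
    have b: "sd2 g \<in> carrier_vec k" and a: "sd g \<in> V" by simp_all
    have "\<rho> g = \<rho> (\<zeta> (sd2 g) * \<gamma> (sd g))"
      using g \<gamma>[OF a] \<zeta>[OF b] by (intro dep mult_closed) (auto simp: superdiag_G intro!: eq_vecI)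
    also have "\<dots> = \<theta> (c \<bullet> sd2 g) \<cdot>\<^sub>m \<rho> (\<gamma> (sd g))" by (rule center_mult[OF b \<gamma>(1)[OF a]])
    finally show ?thesis by (simp add: \<nu>[OF r] smult_smult_mat)
  qed
  have "\<nu> (a + b) = \<nu> a * \<nu> b" if a: "a \<in> path_radical c" and b: "b \<in> path_radical c" for a b
  proof -
    note \<gamma>a = \<gamma>[OF radV[OF a]] and \<gamma>b = \<gamma>[OF radV[OF b]]
    \<comment> \<open>Isotropy enters here: the product of the lifts acquires the second
      superdiagonal term \<open>path_form c a b\<close>, which is zero.\<close>
    have "c \<bullet> sd2 (\<gamma> a * \<gamma> b) = 0"
      using scalar_prod_sd2_mult[OF c \<gamma>a(1) \<gamma>b(1)] \<gamma>a \<gamma>b path_radical_isotropic[OF a b] c by simp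
    moreover have "sd (\<gamma> a * \<gamma> b) = a + b" using \<gamma>a \<gamma>b by (simp add: superdiag_G)
    moreover have "a + b \<in> path_radical c" using sub a b by (simp add: vec_subgroup_def)
    ultimately have "\<rho> (\<gamma> a * \<gamma> b) = \<nu> (a + b) \<cdot>\<^sub>m 1\<^sub>m d"
      using rad_scalar[of "\<gamma> a * \<gamma> b"] \<gamma>a \<gamma>b by (simp add: mult_closed)
    thus ?thesis using \<gamma>a \<gamma>b \<nu>[OF a] \<nu>[OF b] d
      by (simp add: mult smult_one_mat_mult smult_one_mat_eq_iff)
  qed
  moreover have "\<nu> (0\<^sub>v (Suc k)) = 1"
  proof -
    have "(1::complex) \<cdot>\<^sub>m 1\<^sub>m d = \<nu> (0\<^sub>v (Suc k)) \<cdot>\<^sub>m 1\<^sub>m d"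
      using rad_scalar[of "1\<^sub>m (Suc (Suc k))"] one one_closed c by simp
    thus ?thesis using d smult_one_mat_eq_iff by metis
  qed
  ultimately have "\<exists>y\<in>V. \<forall>a\<in>path_radical c. \<nu> a = \<theta> (y \<bullet> a)"
    by (rule vec_subgroup_character_extends[OF sub])
  then obtain y where y: "y \<in> V" and \<nu>y: "\<And>a. a \<in> path_radical c \<Longrightarrow> \<nu> a = \<theta> (y \<bullet> a)"
    by blast
  define \<mu> where "\<mu> g = \<theta> (c \<bullet> sd2 g + y \<bullet> sd g)" for g
  have rad_scalar': "\<rho> g = \<mu> g \<cdot>\<^sub>m 1\<^sub>m d" if "g \<in> radical_preimage c" for g
    using that rad_scalar[of g] by (simp add: radical_preimage_def \<nu>y add \<mu>_def)
  have "(\<Sum>g\<in>carrier G. mat_trace (\<rho> g) * mat_trace (\<rho> (inv\<^bsub>G\<^esub> g))) =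
      (\<Sum>g\<in>radical_preimage c. mat_trace (\<rho> g) * mat_trace (\<rho> (inv\<^bsub>G\<^esub> g)))"
    by (rule sum.mono_neutral_right) (auto simp: radical_preimage_def tr0)
  \<comment> \<open>The scalars of \<open>g\<close> and of its inverse cancel, so each summand is
    \<open>d * d\<close>.\<close>
  also have "\<dots> = (\<Sum>g\<in>radical_preimage c. of_nat (d * d))"
  proof (rule sum.cong[OF refl])
    fix g assume g: "g \<in> radical_preimage c"
    hence gG: "g \<in> carrier G" "inv\<^bsub>G\<^esub> g \<in> carrier G" by (auto simp: radical_preimage_def)
    have "\<mu> g \<cdot>\<^sub>m \<rho> (inv\<^bsub>G\<^esub> g) = 1\<^sub>m d"
      using mult[OF gG] r_inv[OF gG(1)] one rad_scalar'[OF g] car[OF gG(2)]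
      by (simp add: mult_smult_assoc_mat[of _ d d _ d])
    hence "\<mu> g * mat_trace (\<rho> (inv\<^bsub>G\<^esub> g)) = of_nat d"
      using mat_trace_smult[OF car[OF gG(2)], of "\<mu> g"] mat_trace_smult_one[of 1 d] by simp
    thus "mat_trace (\<rho> g) * mat_trace (\<rho> (inv\<^bsub>G\<^esub> g)) = of_nat (d * d)"
      by (simp add: rad_scalar'[OF g] mult.assoc)
  qed
  finally have "of_nat (card (carrier G)) = (of_nat (card (radical_preimage c) * (d * d)) :: complex)"
    using irreducible_rep_norm[OF irr finite_carrier] by simp
  hence "card (carrier G) = card (radical_preimage c) * (d * d)" unfolding of_nat_eq_iff .
  moreover have "card (radical_preimage c) > 0"
    using one_radical_preimage[OF c] by (auto simp: card_gt_0_iff radical_preimage_def)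
  ultimately have "real (card (carrier G)) / card (radical_preimage c) = (real d)\<^sup>2"
    by (simp add: power2_eq_square)
  hence "heis_degree c = of_nat d" by (simp add: heis_degree_def)
  hence "mat_trace (\<rho> g) = heis_char c y g" if "g \<in> carrier G" for g
    using that rad_scalar'[of g] tr0[of g]
    by (auto simp: heis_char_def radical_preimage_def \<mu>_def)
  thus ?thesis using that c y by blast
qed

text \<open>Induction from the center gives some representation with the central scalars of
  \<open>c\<close>, and an irreducible one with the same scalars exists. By
  \<open>irreducible_rep_heis_char\<close> its trace is some \<open>heis_char c' y'\<close>; values
  at zero first superdiagonal show \<open>c = c'\<close>, and a twist moves \<open>y'\<close> to
  \<open>y\<close>.\<close>

lemma heis_char_irreducible:
  assumes c: "c \<in> carrier_vec k" and y: "y \<in> V"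
  obtains d \<rho> where "irreducible_rep G d \<rho>" "\<And>g. g \<in> carrier G \<Longrightarrow> mat_trace (\<rho> g) = heis_char c y g"
proof -
  have dc [simp]: "dim_vec c = k" using c by simp
  define N where "N = card V"
  have N: "N > 0" by (simp add: N_def card_gt_0_iff)
  obtain e where e: "bij_betw e {0..<N} V"
    using ex_bij_betw_nat_finite[of V] by (auto simp: N_def)
  have eV [simp]: "e i \<in> V" "dim_vec (e i) = Suc k" if "i < N" for i
    using bij_betwE[OF e] that by (auto dest: carrier_vecD)
  have inj: "e i = e j \<longleftrightarrow> i = j" if "i < N" "j < N" for i j
    using bij_betw_imp_inj_on[OF e] that by (auto simp: inj_on_def)
  have surj: "\<exists>q<N. e q = x" if "x \<in> V" for x
    using bij_betw_imp_surj_on[OF e] that by (metis atLeastLessThan_iff imageE)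
  \<comment> \<open>The representation induced from the center, on functions on \<open>V\<close>:
    \<open>(\<rho> g f) x = \<theta> (c \<bullet> sd2 g + path_form c x (sd g)) * f (x + sd g)\<close>.\<close>
  define \<rho> where "\<rho> g = mat N N (\<lambda>(i, j). if e j = e i + sd g
    then \<theta> (c \<bullet> sd2 g + path_form c (e i) (sd g)) else 0)" for g
  have "\<rho> \<in> hom G (GL N)"
    unfolding hom_GL_iff
  proof (intro conjI ballI)
    show "\<rho> \<one>\<^bsub>G\<^esub> = 1\<^sub>m N"
      using c by (intro eq_matI) (auto simp: \<rho>_def path_form_def inj)
    fix g h assume g: "g \<in> carrier G" and h: "h \<in> carrier G"
    show "\<rho> (g \<otimes>\<^bsub>G\<^esub> h) = \<rho> g * \<rho> h"
    proof (rule eq_matI)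
      fix i j assume "i < dim_row (\<rho> g * \<rho> h)" "j < dim_col (\<rho> g * \<rho> h)"
      hence ij: "i < N" "j < N" by (auto simp: \<rho>_def)
      obtain q where q: "q < N" "e q = e i + sd g" using surj[of "e i + sd g"] ij by auto
      have eq: "e p = e i + sd g \<longleftrightarrow> p = q" if "p < N" for p using inj[OF that q(1)] q(2) by simp
      have "(\<rho> g * \<rho> h) $$ (i, j) = (\<Sum>p<N. \<rho> g $$ (i, p) * \<rho> h $$ (p, j))"
        using ij by (intro mult_mat_entry) (auto simp: \<rho>_def)
      also have "\<dots> = (\<Sum>p<N. if p = q then \<rho> g $$ (i, q) * \<rho> h $$ (q, j) else 0)"
        using ij by (intro sum.cong) (auto simp: \<rho>_def eq)
      also have "\<dots> = \<rho> g $$ (i, q) * \<rho> h $$ (q, j)" using q(1) by simp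
      also have "\<dots> = (if e j = e i + sd g + sd h then
          \<theta> (c \<bullet> sd2 g + path_form c (e i) (sd g)) * \<theta> (c \<bullet> sd2 h + path_form c (e i + sd g) (sd h)) else 0)"
        using ij q by (simp add: \<rho>_def)
      also have "\<dots> = \<rho> (g * h) $$ (i, j)"
        using ij g h by (simp add: \<rho>_def superdiag_G(1) assoc_add_vec[of _ "Suc k"] scalar_prod_sd2_mult[OF c]
            path_form_add_left path_form_add_right add_ac flip: add)
      finally show "\<rho> (g \<otimes>\<^bsub>G\<^esub> h) $$ (i, j) = (\<rho> g * \<rho> h) $$ (i, j)" by simp
    qed (auto simp: \<rho>_def)
  qed (auto simp: \<rho>_def)
  moreover have "\<rho> z = \<theta> (c \<bullet> sd2 z) \<cdot>\<^sub>m 1\<^sub>m N" if "z \<in> {z \<in> carrier G. sd z = 0\<^sub>v (Suc k)}" for z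
    using that by (intro eq_matI) (auto simp: \<rho>_def path_form_def inj)
  ultimately obtain d \<rho>' where irr: "irreducible_rep G d \<rho>'"
    and sc: "\<And>z. z \<in> {z \<in> carrier G. sd z = 0\<^sub>v (Suc k)} \<Longrightarrow> \<rho>' z = \<theta> (c \<bullet> sd2 z) \<cdot>\<^sub>m 1\<^sub>m d"
    using irreducible_rep_exists[of \<rho> N "{z \<in> carrier G. sd z = 0\<^sub>v (Suc k)}" "\<lambda>z. \<theta> (c \<bullet> sd2 z)"] N by blast
  have tr: "mat_trace (\<rho>' z) = of_nat d * \<theta> (c \<bullet> sd2 z)" if "z \<in> carrier G" "sd z = 0\<^sub>v (Suc k)" for z
    using sc that by simp
  have "mat_trace (\<rho>' z) = mat_trace (\<rho>' \<one>\<^bsub>G\<^esub>)" if "z \<in> superdiag_kernel k" for z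
    using tr[of z] tr[of "\<one>\<^bsub>G\<^esub>"] that c one_closed by (simp add: superdiag_kernel_G)
  then obtain c' y' where c': "c' \<in> carrier_vec k" "y' \<in> V"
    and tr': "\<And>g. g \<in> carrier G \<Longrightarrow> mat_trace (\<rho>' g) = heis_char c' y' g"
    using irreducible_rep_heis_char[OF irr] by blast
  have eq: "of_nat d * \<theta> (c \<bullet> b) = heis_degree c' * \<theta> (c' \<bullet> b)" if b: "b \<in> carrier_vec k" for b
  proof -
    obtain z where "z \<in> carrier G" "sd z = 0\<^sub>v (Suc k)" "sd2 z = b"
      using superdiag_G_surj[of "0\<^sub>v (Suc k)" b] b by auto
    thus ?thesis using tr[of z] tr'[of z] heis_char_center[OF c', of z] by simp
  qed
  \<comment> \<open>At \<open>b = 0\<close> both factors \<open>\<theta>\<close> are 1, so the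
    degrees agree and cancel for the other \<open>b\<close>.\<close>
  have "of_nat d = heis_degree c'" using eq[of "0\<^sub>v k"] c c' by simp
  hence "c = c'"
    using eq heis_degree_nonzero[OF c'(1)] by (intro scalar_prod_character_eq[OF c c'(1)]) auto
  have "irreducible_rep G d (\<lambda>g. \<theta> ((y - y') \<bullet> sd g) \<cdot>\<^sub>m \<rho>' g)"
    by (rule irreducible_rep_twist[OF irr])
      (use y c' in \<open>simp_all add: superdiag_G scalar_prod_add_distrib[of _ "Suc k"] add\<close>)
  moreover have "mat_trace (\<theta> ((y - y') \<bullet> sd g) \<cdot>\<^sub>m \<rho>' g) = heis_char c y g" if g: "g \<in> carrier G" for g
  proof -
    have "mat_trace (\<theta> ((y - y') \<bullet> sd g) \<cdot>\<^sub>m \<rho>' g) = \<theta> ((y - y') \<bullet> sd g) * heis_char c y' g"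
      using tr'[OF g] \<open>c = c'\<close> by (simp add: mat_trace_smult[OF irreducible_repD(3)[OF irr g]])
    also have "\<dots> = heis_char c y g"
      using g y c' by (simp add: heis_char_def minus_scalar_prod_distrib[of _ "Suc k"] add.commute flip: add)
    finally show ?thesis .
  qed
  ultimately show ?thesis by (rule that)
qed

theorem Heisenberg_characters_eq:
  "Heisenberg_characters G = (\<Union>c\<in>carrier_vec k. heis_char c ` V)"
proof (intro equalityI subsetI)
  fix \<chi> assume "\<chi> \<in> Heisenberg_characters G"
  then obtain d \<rho> where irr: "irreducible_rep G d \<rho>" and \<chi>: "\<chi> = (\<lambda>g\<in>carrier G. mat_trace (\<rho> g))"
    and ker: "superdiag_kernel k \<subseteq> character_kernel G \<chi>"
    unfolding Heisenberg_characters_def irreducible_characters_def commutator_subgroup_eq by blast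
  have "mat_trace (\<rho> z) = mat_trace (\<rho> \<one>\<^bsub>G\<^esub>)" if "z \<in> superdiag_kernel k" for z
    using ker that one_closed unfolding character_kernel_def \<chi> by auto
  then obtain c y where "c \<in> carrier_vec k" "y \<in> V" "\<And>g. g \<in> carrier G \<Longrightarrow> mat_trace (\<rho> g) = heis_char c y g"
    using irreducible_rep_heis_char[OF irr] by blast
  moreover from this have "\<chi> = heis_char c y" unfolding \<chi> by (auto simp: heis_char_def fun_eq_iff)
  ultimately show "\<chi> \<in> (\<Union>c\<in>carrier_vec k. heis_char c ` V)" by blast
next
  fix \<chi> assume "\<chi> \<in> (\<Union>c\<in>carrier_vec k. heis_char c ` V)"
  then obtain c y where c: "c \<in> carrier_vec k" and y: "y \<in> V" and \<chi>: "\<chi> = heis_char c y" by blast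
  obtain d \<rho> where \<rho>: "irreducible_rep G d \<rho>" "\<And>g. g \<in> carrier G \<Longrightarrow> mat_trace (\<rho> g) = heis_char c y g"
    using heis_char_irreducible[OF c y] by blast
  have "\<chi> = (\<lambda>g\<in>carrier G. mat_trace (\<rho> g))" unfolding \<chi> using \<rho>(2) by (auto simp: heis_char_def fun_eq_iff)
  hence "\<chi> \<in> irreducible_characters G" using \<rho>(1) unfolding irreducible_characters_def by blast
  moreover have "superdiag_kernel k \<subseteq> character_kernel G \<chi>"
    using heis_char_center[OF c y] one_closed c unfolding \<chi>
    by (auto simp: character_kernel_def superdiag_kernel_G)
  ultimately show "\<chi> \<in> Heisenberg_characters G"
    unfolding Heisenberg_characters_def commutator_subgroup_eq by blast
qed

text \<open>\<open>c\<close> is read off on matrices with zero first superdiagonal, \<open>y\<close>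
  on lifts of radical elements. Two vectors \<open>y\<close> agree there exactly when
  \<open>\<theta>\<close> is trivial on the products of their difference with the radical, and
  duality places that difference in the image.\<close>

lemma heis_char_eq_iff:
  assumes c: "c \<in> carrier_vec k" "c' \<in> carrier_vec k" and y: "y \<in> V" "y' \<in> V"
  shows "heis_char c y = heis_char c' y' \<longleftrightarrow> c = c' \<and> y - y' \<in> path_grad c ` V"
proof -
  have ann: "y - y' \<in> path_grad c ` V \<longleftrightarrow> (\<forall>a\<in>path_radical c. \<theta> (y \<bullet> a) = \<theta> (y' \<bullet> a))"
  proof -
    have "y - y' \<in> path_grad c ` V \<longleftrightarrow> (\<forall>a\<in>path_radical c. \<theta> ((y - y') \<bullet> a) = 1)"
      using path_radical_annihilator[of "y - y'" c] c y by simp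
    also have "\<dots> \<longleftrightarrow> (\<forall>a\<in>path_radical c. \<theta> (y \<bullet> a) = \<theta> (y' \<bullet> a))"
      using c y by (intro ball_cong refl) (auto simp: path_radical_def minus_scalar_prod_distrib[of _ "Suc k"] diff)
    finally show ?thesis .
  qed
  show ?thesis unfolding ann
  proof
    assume eq: "heis_char c y = heis_char c' y'"
    have eq': "heis_degree c * \<theta> (c \<bullet> b) = heis_degree c' * \<theta> (c' \<bullet> b)" if b: "b \<in> carrier_vec k" for b
    proof -
      obtain z where "z \<in> carrier G" "sd z = 0\<^sub>v (Suc k)" "sd2 z = b"
        using superdiag_G_surj[of "0\<^sub>v (Suc k)" b] b by auto
      thus ?thesis using eq heis_char_center[OF c(1) y(1), of z] heis_char_center[OF c(2) y(2), of z] by simp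
    qed
    have "heis_degree c = heis_degree c'" using eq'[of "0\<^sub>v k"] c by simp
    hence cc: "c = c'"
      using eq' heis_degree_nonzero[OF c(1)] by (intro scalar_prod_character_eq[OF c]) auto
    have "\<theta> (y \<bullet> a) = \<theta> (y' \<bullet> a)" if a: "a \<in> path_radical c" for a
    proof -
      have "a \<in> V" using a c by (simp add: path_radical_def)
      then obtain g where g: "g \<in> carrier G" "sd g = a" "sd2 g = 0\<^sub>v k"
        using superdiag_G_surj[of a "0\<^sub>v k"] by auto
      have "heis_char c y g = heis_char c y' g" using eq cc by simp
      thus ?thesis using g a c heis_degree_nonzero[OF c(1)] by (simp add: heis_char_def)
    qed
    thus "c = c' \<and> (\<forall>a\<in>path_radical c. \<theta> (y \<bullet> a) = \<theta> (y' \<bullet> a))" using cc by blast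
  next
    assume "c = c' \<and> (\<forall>a\<in>path_radical c. \<theta> (y \<bullet> a) = \<theta> (y' \<bullet> a))"
    thus "heis_char c y = heis_char c' y'" by (auto simp: heis_char_def add)
  qed
qed

text \<open>The fibres of \<open>heis_char c\<close> on \<open>V\<close> are cosets of the image of
  \<open>path_grad c\<close>, so the count is the index of this image in \<open>V\<close>, which is
  the size of the kernel.\<close>

lemma card_heis_char_image:
  assumes c: "c \<in> carrier_vec k"
  shows "card (heis_char c ` V) = card (path_radical c)"
proof -
  let ?I = "path_grad c ` V"
  have dc: "dim_vec c = k" using c by simp
  have IV: "?I \<subseteq> V" using path_grad_carrier[of c] dc by auto
  have fibre: "card {y' \<in> V. heis_char c y' = heis_char c y} = card ?I" if y: "y \<in> V" for y
  proof -
    have cancel: "u + y - y = u" "u - y + y = u" if "u \<in> V" for u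
      using y that by (auto intro!: eq_vecI)
    have "{y' \<in> V. heis_char c y' = heis_char c y} = {y' \<in> V. y' - y \<in> ?I}"
      using heis_char_eq_iff[OF c c _ y] by auto
    also have "bij_betw (\<lambda>u. u + y) ?I \<dots>"
      by (rule bij_betw_byWitness[where f' = "\<lambda>y'. y' - y"]) (use y IV cancel in \<open>auto simp: subset_iff image_iff\<close>)
    from bij_betw_same_card[OF this] show "card {y' \<in> V. heis_char c y' = heis_char c y} = card ?I"
      using \<open>{y' \<in> V. heis_char c y' = heis_char c y} = {y' \<in> V. y' - y \<in> ?I}\<close> by simp
  qed
  have "card V = (\<Sum>\<chi>\<in>heis_char c ` V. card {y' \<in> V. heis_char c y' = \<chi>})"
    unfolding card_eq_sum by (rule sum.image_gen) simp
  also have "\<dots> = (\<Sum>\<chi>\<in>heis_char c ` V. card ?I)"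
    by (intro sum.cong refl) (use fibre in blast)
  finally have "card V = card (heis_char c ` V) * card ?I" by simp
  moreover have "card ?I * card (path_radical c) = card V"
    using card_path_grad_image[of c] dc by simp
  moreover have "card ?I > 0" by (simp add: card_gt_0_iff)
  ultimately show ?thesis by (metis mult.commute mult_left_cancel not_gr_zero)
qed

section \<open>Invariance under the superdiagonal characters\<close>

abbreviation ones :: "'a vec" where "ones \<equiv> vec (Suc k) (\<lambda>_. 1)"

lemma superdiagonal_sum_eq: "superdiagonal_sum (Suc (Suc k)) g = ones \<bullet> sd g"
  by (simp add: superdiagonal_sum_def scalar_prod_def superdiag_def lessThan_atLeast0)

text \<open>In one direction the single character coming from \<open>\<theta>\<close> is enough of a
  test. In the other, \<open>ones = path_grad c v\<close> makes the superdiagonal sum vanish over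
  the radical in the field itself, so every additive character takes the value 1 on it.\<close>

lemma invariant_heis_char_iff:
  assumes c: "c \<in> carrier_vec k" and y: "y \<in> V"
  shows "invariant_under G (superdiagonal_characters TYPE('a) (Suc (Suc k))) (heis_char c y) \<longleftrightarrow>
    ones \<in> path_grad c ` V"
proof
  assume inv: "invariant_under G (superdiagonal_characters TYPE('a) (Suc (Suc k))) (heis_char c y)"
  have "\<theta> \<in> additive_characters TYPE('a)" by (simp add: additive_characters_iff add)
  hence "restrict (\<theta> \<circ> superdiagonal_sum (Suc (Suc k))) (carrier G) \<in>
      superdiagonal_characters TYPE('a) (Suc (Suc k))"
    unfolding superdiagonal_characters_def G by blast
  hence eq: "(\<lambda>g\<in>carrier G. restrict (\<theta> \<circ> superdiagonal_sum (Suc (Suc k))) (carrier G) g * heis_char c y g) =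
      heis_char c y"
    using inv unfolding invariant_under_def by blast
  have "\<theta> (ones \<bullet> a) = 1" if a: "a \<in> path_radical c" for a
  proof -
    have "a \<in> V" using a c by (simp add: path_radical_def)
    then obtain g where g: "g \<in> carrier G" "sd g = a" "sd2 g = 0\<^sub>v k"
      using superdiag_G_surj[of a "0\<^sub>v k"] by auto
    have "\<theta> (ones \<bullet> a) * heis_char c y g = heis_char c y g"
      using fun_cong[OF eq, of g] g by (simp add: superdiagonal_sum_eq)
    moreover have "heis_char c y g \<noteq> 0"
      using g a heis_degree_nonzero[OF c] by (simp add: heis_char_def)
    ultimately show ?thesis by simp
  qed
  thus "ones \<in> path_grad c ` V" using path_radical_annihilator[of ones c] c by simp
next
  assume "ones \<in> path_grad c ` V"
  then obtain v where v: "v \<in> V" "ones = path_grad c v" by blast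
  have ones0: "ones \<bullet> a = 0" if "a \<in> path_radical c" for a
    using that c v path_radical_symmetric[OF that, of v]
    by (simp add: v(2) path_grad_scalar_prod path_radical_def)
  have "(\<lambda>g\<in>carrier G. \<psi> g * heis_char c y g) = heis_char c y"
    if "\<psi> \<in> superdiagonal_characters TYPE('a) (Suc (Suc k))" for \<psi>
  proof -
    have "\<exists>\<theta>'. \<psi> = restrict (\<theta>' \<circ> superdiagonal_sum (Suc (Suc k))) (carrier G) \<and>
        \<theta>' \<in> additive_characters TYPE('a)"
      using that unfolding superdiagonal_characters_def G mem_Collect_eq .
    then obtain \<theta>' where \<theta>': "\<theta>' \<in> additive_characters TYPE('a)"
      and \<psi>: "\<psi> = restrict (\<theta>' \<circ> superdiagonal_sum (Suc (Suc k))) (carrier G)"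
      by (elim exE conjE)
    have "\<theta>' (0 + 0) = \<theta>' 0 * \<theta>' 0" "\<theta>' 0 \<noteq> 0" using \<theta>' unfolding additive_characters_iff by blast+
    hence "\<theta>' 0 = 1" by simp
    thus ?thesis by (auto simp: \<psi> heis_char_def superdiagonal_sum_eq ones0 fun_eq_iff)
  qed
  thus "invariant_under G (superdiagonal_characters TYPE('a) (Suc (Suc k))) (heis_char c y)"
    unfolding invariant_under_def by blast
qed

theorem invariant_Heisenberg_characters:
  defines "X \<equiv> {\<chi> \<in> Heisenberg_characters G.
    invariant_under G (superdiagonal_characters TYPE('a) (Suc (Suc k))) \<chi>}"
  shows "finite X" and "card X = card {(c, v). c \<in> carrier_vec k \<and> v \<in> V \<and> path_grad c v = ones}"
proof -
  let ?C = "{c \<in> carrier_vec k. ones \<in> path_grad c ` V}"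
  have X: "X = (\<Union>c\<in>?C. heis_char c ` V)"
    unfolding X_def Heisenberg_characters_eq using invariant_heis_char_iff by blast
  thus "finite X" by simp
  have "card X = (\<Sum>c\<in>?C. card (heis_char c ` V))"
    unfolding X by (rule card_UN_disjoint) (auto simp: heis_char_eq_iff)
  \<comment> \<open>The size of the radical reappears as the number of solutions \<open>v\<close>; a
    vector \<open>c\<close> outside \<open>?C\<close> has no solution.\<close>
  also have "\<dots> = (\<Sum>c\<in>carrier_vec k. card {v \<in> V. path_grad c v = ones})"
  proof (rule sum.mono_neutral_cong_left)
    fix c assume c: "c \<in> ?C"
    hence "dim_vec c = k" by auto
    thus "card (heis_char c ` V) = card {v \<in> V. path_grad c v = ones}"
      using c card_path_grad_fibre[of c ones] card_heis_char_image[of c] by simp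
  qed (auto intro!: image_eqI[OF sym])
  also have "\<dots> = card (SIGMA c:carrier_vec k. {v \<in> V. path_grad c v = ones})" by simp
  also have "(SIGMA c:carrier_vec k. {v \<in> V. path_grad c v = ones}) =
      {(c, v). c \<in> carrier_vec k \<and> v \<in> V \<and> path_grad c v = ones}" by auto
  finally show "card X = card {(c, v). c \<in> carrier_vec k \<and> v \<in> V \<and> path_grad c v = ones}" .
qed

end

section \<open>Counting solutions along the path\<close>

text \<open>Reading the equations \<open>path_grad c v = ones\<close> from left to right, the state before the pair
  \<open>(c\<^sub>j, v\<^sub>j\<^sub>+\<^sub>1)\<close> consists of \<open>s = c\<^sub>j\<^sub>-\<^sub>1 v\<^sub>j\<^sub>-\<^sub>1\<close> and \<open>w = v\<^sub>j\<close>, and the \<open>j\<close>-th equation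
  is \<open>s - c\<^sub>j v\<^sub>j\<^sub>+\<^sub>1 = 1\<close>.\<close>

fun path_solution :: "'a::field \<Rightarrow> 'a \<Rightarrow> ('a \<times> 'a) list \<Rightarrow> bool" where
  "path_solution s w [] \<longleftrightarrow> s = 1"
| "path_solution s w ((c, v) # ps) \<longleftrightarrow> c * v = s - 1 \<and> path_solution (c * w) v ps"

text \<open>Unrolled into one equation per vertex, the shape that matches the coordinates of
  \<open>path_grad\<close>; \<open>s\<close> stands for the product arriving from the left of the
  first vertex.\<close>

lemma path_solution_iff:
  "path_solution s w ps \<longleftrightarrow> (\<forall>j<Suc (length ps).
     (case j of 0 \<Rightarrow> s | Suc i \<Rightarrow> fst (ps ! i) * (w # map snd ps) ! i) -
     (if j < length ps then fst (ps ! j) * snd (ps ! j) else 0) = 1)"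
proof (induction s w ps rule: path_solution.induct)
  case (2 s w c v ps)
  have "path_solution s w ((c, v) # ps) \<longleftrightarrow> s - c * v = 1 \<and> path_solution (c * w) v ps"
    by (auto simp: algebra_simps)
  also have "\<dots> \<longleftrightarrow> (\<forall>j<Suc (length ((c, v) # ps)).
     (case j of 0 \<Rightarrow> s | Suc i \<Rightarrow> fst (((c, v) # ps) ! i) * (w # map snd ((c, v) # ps)) ! i) -
     (if j < length ((c, v) # ps) then fst (((c, v) # ps) ! j) * snd (((c, v) # ps) ! j) else 0) = 1)"
    unfolding 2 by (subst (2) All_less_Suc2) (auto simp: nth_Cons split: nat.splits)
  finally show ?case .
qed simp

text \<open>The first vertex has no left neighbour, hence the initial state \<open>s = 0\<close>;
  \<open>w\<close> is the entry of the vector at that vertex.\<close>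

lemma path_grad_eq_ones_iff:
  assumes "length ps = k"
  shows "path_grad (vec k (\<lambda>i. fst (ps ! i))) (vec (Suc k) (\<lambda>i. (w # map snd ps) ! i)) = vec (Suc k) (\<lambda>_. 1)
    \<longleftrightarrow> path_solution 0 w ps"
proof -
  let ?g = "path_grad (vec k (\<lambda>i. fst (ps ! i))) (vec (Suc k) (\<lambda>i. (w # map snd ps) ! i))"
  have entry: "?g $ j = (case j of 0 \<Rightarrow> 0 | Suc i \<Rightarrow> fst (ps ! i) * (w # map snd ps) ! i) -
      (if j < k then fst (ps ! j) * snd (ps ! j) else 0)" if "j < Suc k" for j
    using that assms by (cases j) (simp_all add: path_grad_def)
  have "?g = vec (Suc k) (\<lambda>_. 1) \<longleftrightarrow> (\<forall>j<Suc k. ?g $ j = 1)"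
    by (simp add: vec_eq_iff)
  also have "\<dots> \<longleftrightarrow> path_solution 0 w ps"
    unfolding path_solution_iff assms using entry by (metis (no_types, lifting))
  finally show ?thesis .
qed

lemma card_path_grad_eq_ones:
  "card {(c, v). c \<in> carrier_vec k \<and> v \<in> carrier_vec (Suc k) \<and>
      path_grad c v = vec (Suc k) (\<lambda>_. 1 :: 'a::{field,finite})} =
    (\<Sum>w\<in>UNIV. card {ps :: ('a \<times> 'a) list. length ps = k \<and> path_solution 0 w ps})"
proof -
  let ?A = "SIGMA w:UNIV. {ps :: ('a \<times> 'a) list. length ps = k \<and> path_solution 0 w ps}"
  let ?B = "{(c, v). c \<in> carrier_vec k \<and> v \<in> carrier_vec (Suc k) \<and> path_grad c v = vec (Suc k) (\<lambda>_. 1 :: 'a)}"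
  \<comment> \<open>Each edge weight is paired with the vector entry at its right end, and the
    leftmost entry remains as \<open>w\<close>.\<close>
  let ?f = "\<lambda>(w, ps). (vec k (\<lambda>i. fst (ps ! i)), vec (Suc k) (\<lambda>i. (w # map snd ps) ! i) :: 'a vec)"
  let ?g = "\<lambda>(c, v). (v $ 0, map (\<lambda>i. (c $ i, v $ Suc i)) [0..<k])"
  have "bij_betw ?f ?A ?B"
  proof (rule bij_betw_byWitness[where f' = ?g])
    show "\<forall>a\<in>?A. ?g (?f a) = a" by (auto simp: list_eq_iff_nth_eq)
    show fg: "\<forall>b\<in>?B. ?f (?g b) = b"
    proof
      fix b assume "b \<in> ?B"
      then obtain c v where b: "b = (c, v)" "c \<in> carrier_vec k" "v \<in> carrier_vec (Suc k)" by blast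
      let ?ps = "map (\<lambda>i. (c $ i, v $ Suc i)) [0..<k]"
      have "vec k (\<lambda>i. fst (?ps ! i)) = c" using b(2) by (intro eq_vecI) auto
      moreover have "vec (Suc k) (\<lambda>i. (v $ 0 # map snd ?ps) ! i) = v"
      proof (rule eq_vecI)
        fix i assume "i < dim_vec v"
        thus "vec (Suc k) (\<lambda>i. (v $ 0 # map snd ?ps) ! i) $ i = v $ i" using b(3) by (cases i) auto
      qed (use b(3) in simp)
      ultimately show "?f (?g b) = b" unfolding b(1) prod.case by (simp only:)
    qed
    show "?f ` ?A \<subseteq> ?B" by (auto simp: path_grad_eq_ones_iff)
    show "?g ` ?B \<subseteq> ?A"
    proof
      fix a assume "a \<in> ?g ` ?B"
      then obtain b where b: "b \<in> ?B" "a = ?g b" by blast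
      obtain c v where cv: "b = (c, v)" by (cases b)
      let ?ps = "map (\<lambda>i. (c $ i, v $ Suc i)) [0..<k]"
      have "?f (v $ 0, ?ps) = (c, v)" using fg b(1) cv by fastforce
      hence "path_solution 0 (v $ 0) ?ps"
        using b(1) cv by (subst path_grad_eq_ones_iff[of ?ps k, symmetric]) auto
      thus "a \<in> ?A" using b(2) cv by simp
    qed
  qed
  hence "card ?B = card ?A" by (rule bij_betw_same_card[symmetric])
  also have "\<dots> = (\<Sum>w\<in>UNIV. card {ps :: ('a \<times> 'a) list. length ps = k \<and> path_solution 0 w ps})"
  proof (rule card_SigmaI)
    have "finite {ps :: ('a \<times> 'a) list. length ps = k \<and> path_solution 0 w ps}" for w
      by (rule finite_subset[OF _ finite_lists_length_eq[of "UNIV :: ('a \<times> 'a) set" k]]) auto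
    thus "\<forall>w\<in>UNIV. finite {ps :: ('a \<times> 'a) list. length ps = k \<and> path_solution 0 w ps}" by blast
  qed simp
  finally show ?thesis .
qed

section \<open>The transfer recursion\<close>

text \<open>The number of solutions depends on \<open>s\<close> and \<open>w\<close> only through \<open>s = 1\<close> and \<open>w = 0\<close>.\<close>

fun path_count :: "int \<Rightarrow> nat \<Rightarrow> bool \<Rightarrow> bool \<Rightarrow> int" where
  "path_count t 0 s1 w0 = (if s1 then 1 else 0)"
| "path_count t (Suc r) True True = (1 + t) * path_count t r False True + t * path_count t r False False"
| "path_count t (Suc r) False True = t * path_count t r False False"
| "path_count t (Suc r) True False =
     path_count t r True True + t * path_count t r False True + t * path_count t r False False"
| "path_count t (Suc r) False False = path_count t r True False + (t - 1) * path_count t r False False"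

text \<open>Exactly one nonzero \<open>c\<close>, the inverse of \<open>w\<close>, satisfies
  \<open>c * w = 1\<close>.\<close>

lemma sum_nonzero_scaled:
  fixes w :: "'a::{field,finite}" and g :: "bool \<Rightarrow> int"
  assumes "w \<noteq> 0"
  shows "(\<Sum>c\<in>UNIV - {0}. g (c * w = 1)) = g True + (int CARD('a) - 2) * g False"
proof -
  have "(\<Sum>c\<in>UNIV - {0}. g (c * w = 1)) = g True + (\<Sum>c\<in>UNIV - {0} - {inverse w}. g (c * w = 1))"
    using assms by (subst sum.remove[of _ "inverse w"]) auto
  also have "(\<Sum>c\<in>UNIV - {0} - {inverse w}. g (c * w = 1)) = (\<Sum>c\<in>UNIV - {0} - {inverse w}. g False)"
    by (intro sum.cong refl arg_cong[of _ _ g]) (auto dest!: inverse_unique simp: mult.commute[of _ w])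
  also have "\<dots> = int (card (UNIV - {0} - {inverse w})) * g False" by simp
  also have "int (card (UNIV - {0} - {inverse w})) = int CARD('a) - 2"
  proof -
    have "card {0, inverse w} \<le> CARD('a)" by (rule card_mono) auto
    moreover have "UNIV - {0} - {inverse w} = UNIV - {0, inverse w}" by auto
    ultimately show ?thesis using assms by (simp add: card_Diff_subset of_nat_diff)
  qed
  finally show ?thesis .
qed

lemma card_nonzero: "int (card (UNIV - {0 :: 'a::{field,finite}})) = int CARD('a) - 1"
  by (simp add: card_Diff_singleton of_nat_diff Suc_leI)

text \<open>The next pair must solve \<open>c * v = s - 1\<close>. If \<open>s = 1\<close>, either
  \<open>c = 0\<close> with \<open>v\<close> arbitrary, or \<open>c \<noteq> 0\<close> with
  \<open>v = 0\<close>; otherwise \<open>c\<close> is nonzero and determines a nonzero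
  \<open>v\<close>. The next state records only whether \<open>c * w = 1\<close> and whether
  \<open>v = 0\<close>, and counting the pairs gives the clauses of
  \<open>path_count\<close>.\<close>

theorem card_path_solution:
  fixes s w :: "'a::{field,finite}"
  defines "t \<equiv> int CARD('a) - 1"
  shows "int (card {ps :: ('a \<times> 'a) list. length ps = r \<and> path_solution s w ps}) =
    path_count t r (s = 1) (w = 0)"
proof (induction r arbitrary: s w)
  case 0
  have "{ps :: ('a \<times> 'a) list. length ps = 0 \<and> path_solution s w ps} = (if s = 1 then {[]} else {})"
    by auto
  thus ?case by simp
next
  case (Suc r)
  let ?S = "\<lambda>r s w. {ps :: ('a \<times> 'a) list. length ps = r \<and> path_solution s w ps}"
  let ?P = "{(c, v). c * v = s - 1}"
  define F where "F c v = path_count t r (c * w = 1) (v = 0)" for c v :: 'a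
  have fin: "finite (?S r s w)" for s w
    by (rule finite_subset[OF _ finite_lists_length_eq[of "UNIV :: ('a \<times> 'a) set" r]]) auto
  have "?S (Suc r) s w = (\<Union>(c, v)\<in>?P. Cons (c, v) ` ?S r (c * w) v)"
  proof (rule Set.set_eqI)
    fix ps :: "('a \<times> 'a) list"
    show "ps \<in> ?S (Suc r) s w \<longleftrightarrow> ps \<in> (\<Union>(c, v)\<in>?P. Cons (c, v) ` ?S r (c * w) v)"
      by (cases ps) (auto simp: image_iff)
  qed
  hence "card (?S (Suc r) s w) = (\<Sum>(c, v)\<in>?P. card (Cons (c, v) ` ?S r (c * w) v))"
    by (simp only: split_def) (rule card_UN_disjoint, use fin in auto)
  also have "int \<dots> = (\<Sum>(c, v)\<in>?P. F c v)"
    unfolding of_nat_sum by (intro sum.cong refl) (auto simp: card_image Suc.IH F_def)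
  finally have eq: "int (card (?S (Suc r) s w)) = (\<Sum>(c, v)\<in>?P. F c v)" .
  show ?case
  proof (cases "s = 1")
    case s: True
    have "?P = {0} \<times> UNIV \<union> (UNIV - {0}) \<times> {0}" by (auto simp: s)
    hence "(\<Sum>(c, v)\<in>?P. F c v) = (\<Sum>(c, v)\<in>{0} \<times> UNIV. F c v) + (\<Sum>(c, v)\<in>(UNIV - {0}) \<times> {0}. F c v)"
      by (simp only:) (rule sum.union_disjoint, auto)
    also have "(\<Sum>(c, v)\<in>{0} \<times> UNIV. F c v) = (\<Sum>v\<in>UNIV. F 0 v)"
      by (simp flip: sum.cartesian_product)
    also have "\<dots> = F 0 0 + (\<Sum>v\<in>UNIV - {0}. F 0 v)" by (rule sum.remove) auto
    also have "(\<Sum>v\<in>UNIV - {0}. F 0 v) = t * path_count t r False False"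
      unfolding t_def card_nonzero[symmetric] by (simp add: F_def t_def)
    also have "(\<Sum>(c, v)\<in>(UNIV - {0}) \<times> {0}. F c v) = (\<Sum>c\<in>UNIV - {0}. path_count t r (c * w = 1) True)"
      by (simp add: F_def flip: sum.cartesian_product)
    also have "\<dots> = (if w = 0 then t * path_count t r False True
        else path_count t r True True + (t - 1) * path_count t r False True)"
      using sum_nonzero_scaled[of w "\<lambda>b. path_count t r b True"] card_nonzero[where ?'a = 'a]
      by (auto simp: t_def)
    finally have "(\<Sum>(c, v)\<in>?P. F c v) = F 0 0 + t * path_count t r False False +
        (if w = 0 then t * path_count t r False True
         else path_count t r True True + (t - 1) * path_count t r False True)" .
    thus ?thesis unfolding eq by (simp only:) (auto simp: s F_def algebra_simps)
  next
    case s: False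
    have "(\<Sum>(c, v)\<in>?P. F c v) = (\<Sum>c\<in>UNIV - {0}. F c ((s - 1) / c))"
      by (rule sum.reindex_bij_witness[where j = fst and i = "\<lambda>c. (c, (s - 1) / c)"])
        (use s in \<open>auto simp: field_simps\<close>)
    also have "\<dots> = (\<Sum>c\<in>UNIV - {0}. path_count t r (c * w = 1) False)"
      by (intro sum.cong refl) (use s in \<open>auto simp: F_def\<close>)
    also have "\<dots> = (if w = 0 then t * path_count t r False False
        else path_count t r True False + (t - 1) * path_count t r False False)"
      using sum_nonzero_scaled[of w "\<lambda>b. path_count t r b False"] card_nonzero[where ?'a = 'a]
      by (auto simp: t_def)
    finally show ?thesis unfolding eq by (auto simp: s)
  qed
qed

text \<open>The initial state has \<open>s = 0\<close>; among the \<open>t + 1\<close> field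
  elements available for the leftmost entry one is zero and \<open>t\<close> are not.\<close>

definition invariant_count :: "int \<Rightarrow> nat \<Rightarrow> int" where
  "invariant_count t k = path_count t k False True + t * path_count t k False False"

text \<open>Three transfer steps eliminate the individual states and leave a recursion for this one
  combination of them.\<close>

lemma invariant_count_rec:
  "invariant_count t 0 = 0" "invariant_count t 1 = t" "invariant_count t 2 = t + t\<^sup>2"
  "invariant_count t (r + 3) = t * invariant_count t (r + 2) + (t + t\<^sup>2) * invariant_count t r"
  by (simp_all add: invariant_count_def numeral_eq_Suc algebra_simps power2_eq_square)

lemma int_card_path_grad_eq_ones:
  "int (card {(c, v). c \<in> carrier_vec k \<and> v \<in> carrier_vec (Suc k) \<and>
      path_grad c v = vec (Suc k) (\<lambda>_. 1 :: 'a::{field,finite})}) = invariant_count (int CARD('a) - 1) k"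
proof -
  let ?t = "int CARD('a) - 1"
  have "int (\<Sum>w\<in>UNIV. card {ps :: ('a \<times> 'a) list. length ps = k \<and> path_solution 0 w ps}) =
      (\<Sum>w\<in>(UNIV :: 'a set). path_count ?t k False (w = 0))"
    by (simp add: card_path_solution)
  also have "\<dots> = path_count ?t k False True + (\<Sum>w\<in>UNIV - {0 :: 'a}. path_count ?t k False (w = 0))"
    by (subst sum.remove[of _ 0]) auto
  also have "(\<Sum>w\<in>UNIV - {0 :: 'a}. path_count ?t k False (w = 0)) =
      (\<Sum>w\<in>UNIV - {0 :: 'a}. path_count ?t k False False)"
    by (intro sum.cong) auto
  also have "\<dots> = ?t * path_count ?t k False False"
    by (simp only: sum_constant card_nonzero)
  finally show ?thesis unfolding card_path_grad_eq_ones invariant_count_def .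
qed

section \<open>Lattice paths\<close>

definition lattice_paths_total :: "nat \<Rightarrow> (nat \<times> nat) list set" where
  "lattice_paths_total m =
     {steps. set steps \<subseteq> {(2, 1), (1, 2), (0, 1)} \<and> fst (sum_list steps) + snd (sum_list steps) = m}"

text \<open>The value of I_{m+1} at \<open>t\<close>, as \<open>poly_I_poly\<close> shows. Grouping
  the paths by the coordinate sum of the endpoint treats all \<open>k\<close> at once and makes
  removal of the first step a recursion in \<open>m\<close> alone.\<close>

definition path_poly :: "int \<Rightarrow> nat \<Rightarrow> int" where
  "path_poly t m = (\<Sum>steps\<in>lattice_paths_total m. t ^ snd (sum_list steps))"

lemma lattice_paths_total_rec:
  "lattice_paths_total 0 = {[]}"
  "lattice_paths_total 1 = Cons (0, 1) ` lattice_paths_total 0"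
  "lattice_paths_total 2 = Cons (0, 1) ` lattice_paths_total 1"
  "lattice_paths_total (m + 3) = Cons (0, 1) ` lattice_paths_total (m + 2) \<union>
     (Cons (2, 1) ` lattice_paths_total m \<union> Cons (1, 2) ` lattice_paths_total m)"
proof -
  have Cons: "x # xs \<in> lattice_paths_total m \<longleftrightarrow>
      (x = (0, 1) \<and> (\<exists>j. m = j + 1 \<and> xs \<in> lattice_paths_total j)) \<or>
      ((x = (2, 1) \<or> x = (1, 2)) \<and> (\<exists>j. m = j + 3 \<and> xs \<in> lattice_paths_total j))" for x xs m
    by (auto simp: lattice_paths_total_def)
  have Nil: "[] \<in> lattice_paths_total m \<longleftrightarrow> m = 0" for m by (auto simp: lattice_paths_total_def)
  have eqI: "A = B" if "[] \<in> A \<longleftrightarrow> [] \<in> B" "\<And>x xs. x # xs \<in> A \<longleftrightarrow> x # xs \<in> B"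
    for A B :: "(nat \<times> nat) list set"
    using that by (metis neq_Nil_conv Set.set_eqI)
  show "lattice_paths_total 0 = {[]}" by (rule eqI) (auto simp: Cons Nil)
  show "lattice_paths_total 1 = Cons (0, 1) ` lattice_paths_total 0" by (rule eqI) (auto simp: Cons Nil)
  show "lattice_paths_total 2 = Cons (0, 1) ` lattice_paths_total 1"
    by (rule eqI) (auto simp: Cons Nil numeral_2_eq_2)
  show "lattice_paths_total (m + 3) = Cons (0, 1) ` lattice_paths_total (m + 2) \<union>
     (Cons (2, 1) ` lattice_paths_total m \<union> Cons (1, 2) ` lattice_paths_total m)"
    by (rule eqI) (auto simp: Cons Nil numeral_3_eq_3)
qed

lemma nat_induct3:
  "P 0 \<Longrightarrow> P 1 \<Longrightarrow> P 2 \<Longrightarrow> (\<And>m. P m \<Longrightarrow> P (m + 1) \<Longrightarrow> P (m + 2) \<Longrightarrow> P (m + 3)) \<Longrightarrow> P (n::nat)"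
proof (induction n rule: less_induct)
  case (less n)
  consider "n = 0" | "n = 1" | "n = 2" | "n = (n - 3) + 3" by linarith
  thus ?case
  proof cases
    case 4
    have "P (n - 3 + 3)" by (rule less.prems(4)) (rule less.IH[OF _ less.prems]; use 4 in simp)+
    thus ?thesis using 4 by simp
  qed (use less.prems in simp_all)
qed

lemma finite_lattice_paths_total [simp]: "finite (lattice_paths_total m)"
  by (induction m rule: nat_induct3) (simp_all only: lattice_paths_total_rec finite.intros finite_imageI finite_UnI)

text \<open>Removing the first step lowers the coordinate sum by 1 for \<open>(0, 1)\<close> and by
  3 for \<open>(2, 1)\<close> and \<open>(1, 2)\<close>; the heights 1, 1 and 2 of these steps are
  the exponents of \<open>t\<close> in the coefficients.\<close>

lemma path_poly_rec:
  "path_poly t 0 = 1" "path_poly t 1 = t" "path_poly t 2 = t\<^sup>2"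
  "path_poly t (m + 3) = t * path_poly t (m + 2) + (t + t\<^sup>2) * path_poly t m"
proof -
  have im: "(\<Sum>steps\<in>Cons x ` A. t ^ snd (sum_list steps)) =
      t ^ snd x * (\<Sum>steps\<in>A. t ^ snd (sum_list steps))" for x :: "nat \<times> nat" and A
    by (subst sum.reindex) (auto simp: power_add sum_distrib_left)
  show 0: "path_poly t 0 = 1" by (simp add: path_poly_def lattice_paths_total_rec(1))
  show 1: "path_poly t 1 = t"
    using 0 unfolding path_poly_def lattice_paths_total_rec(2) im by simp
  show "path_poly t 2 = t\<^sup>2"
    using 1 unfolding path_poly_def lattice_paths_total_rec(3) im by (simp add: power2_eq_square)
  have "path_poly t (m + 3) = (\<Sum>steps\<in>Cons (0, 1) ` lattice_paths_total (m + 2). t ^ snd (sum_list steps)) +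
      ((\<Sum>steps\<in>Cons (2, 1) ` lattice_paths_total m. t ^ snd (sum_list steps)) +
       (\<Sum>steps\<in>Cons (1, 2) ` lattice_paths_total m. t ^ snd (sum_list steps)))"
    unfolding path_poly_def lattice_paths_total_rec(4)
    by (subst sum.union_disjoint; (subst sum.union_disjoint)?) auto
  thus "path_poly t (m + 3) = t * path_poly t (m + 2) + (t + t\<^sup>2) * path_poly t m"
    unfolding im path_poly_def[symmetric] by (simp add: distrib_right)
qed

lemma poly_I_poly: "poly (I_poly (int m + 1)) t = path_poly t m"
proof -
  have Un: "lattice_paths_total m = (\<Union>k\<le>m. lattice_paths (m - k) k)"
    by (auto simp: lattice_paths_total_def lattice_paths_def prod_eq_iff)
  have fin: "finite (lattice_paths (m - k) k)" if "k \<le> m" for k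
    using that finite_subset[OF _ finite_lattice_paths_total[of m]] Un by blast
  have "path_poly t m = (\<Sum>k\<le>m. \<Sum>steps\<in>lattice_paths (m - k) k. t ^ snd (sum_list steps))"
    unfolding path_poly_def Un by (rule sum.UNION_disjoint) (use fin in \<open>auto simp: lattice_paths_def\<close>)
  also have "\<dots> = (\<Sum>k\<le>m. \<Sum>steps\<in>lattice_paths (m - k) k. t ^ k)"
    by (intro sum.cong refl) (auto simp: lattice_paths_def)
  also have "\<dots> = poly (I_poly (int m + 1)) t"
    by (simp add: I_poly_def poly_sum poly_monom)
  finally show ?thesis ..
qed

section \<open>Comparison of the two recursions\<close>

text \<open>Both sides obey the same recursion of order three, so three initial values decide. The
  shift by 2 keeps away from indices at which some \<open>I_poly\<close> is zero by
  convention.\<close>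

lemma invariant_count_eq_path_poly:
  "invariant_count t (r + 2) = t * path_poly t (r + 1) + t * path_poly t r"
proof (induction r rule: nat_induct3)
  case 1
  show ?case unfolding add_0 invariant_count_rec path_poly_rec by (simp add: power2_eq_square)
next
  case 2
  have *: "(1::nat) + 2 = 0 + 3" "(1::nat) + 1 = 2" by simp_all
  show ?case unfolding * invariant_count_rec(4)
    unfolding add_0 invariant_count_rec(1-3) path_poly_rec(1-3)
    by (simp add: algebra_simps power2_eq_square)
next
  case 3
  have *: "(2::nat) + 2 = 1 + 3" "(1::nat) + 2 = 0 + 3" "(2::nat) + 1 = 0 + 3" by simp_all
  show ?case unfolding * invariant_count_rec(4) path_poly_rec(4)
    unfolding add_0 invariant_count_rec(1-3) path_poly_rec(1-3)
    by (simp add: algebra_simps power2_eq_square)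
next
  case (4 m)
  have "invariant_count t (m + 2 + 3) = t * invariant_count t (m + 2 + 2) + (t + t\<^sup>2) * invariant_count t (m + 2)"
    by (rule invariant_count_rec(4))
  moreover have "path_poly t (m + 1 + 3) = t * path_poly t (m + 1 + 2) + (t + t\<^sup>2) * path_poly t (m + 1)"
    "path_poly t (m + 3) = t * path_poly t (m + 2) + (t + t\<^sup>2) * path_poly t m"
    by (rule path_poly_rec(4))+
  ultimately show ?case using 4 by (simp add: algebra_simps)
qed

text \<open>For \<open>k = 0\<close> both indices of \<open>I_poly\<close> are nonpositive and for
  \<open>k = 1\<close> one of them is; there the zero convention supplies the value.\<close>

lemma poly_I_tilde_poly: "poly (I_tilde_poly (int k + 1)) t = invariant_count t k"
proof -
  have nonpos: "poly (I_poly j) t = 0" if "j \<le> 0" for j using that by (simp add: I_poly_def)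
  consider "k = 0" | "k = 1" | r where "k = r + 2"
    using le_Suc_ex[of 2 k] by (cases "k < 2") (force simp: less_2_cases_iff add.commute)+
  thus ?thesis
  proof cases
    case 1
    thus ?thesis by (simp add: I_tilde_poly_def nonpos invariant_count_rec)
  next
    case 2
    thus ?thesis using poly_I_poly[of 0 t]
      by (simp add: I_tilde_poly_def nonpos invariant_count_rec(2)[simplified] path_poly_rec)
  next
    case 3
    have "poly (I_tilde_poly (int k + 1)) t = t * path_poly t (r + 1) + t * path_poly t r"
      using poly_I_poly[of "r + 1" t] poly_I_poly[of r t] 3 by (simp add: I_tilde_poly_def algebra_simps)
    thus ?thesis using invariant_count_eq_path_poly[of t r] 3 by simp
  qed
qed

theorem theorem5p5:
  fixes n :: nat
  defines "G \<equiv> unitriangular_group TYPE('a::{field,finite}) (n + 1)"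
    and "C \<equiv> superdiagonal_characters TYPE('a) (n + 1)"
  assumes "n \<ge> 1"
  shows "finite {\<chi> \<in> Heisenberg_characters G. invariant_under G C \<chi>} \<and>
    int (card {\<chi> \<in> Heisenberg_characters G. invariant_under G C \<chi>})
      = poly (I_tilde_poly (int n)) (int CARD('a) - 1)"
proof -
  \<comment> \<open>The matrix size \<open>n + 1\<close> is \<open>k + 2\<close>, so the path has
    \<open>n\<close> vertices and \<open>k\<close> edges.\<close>
  obtain k where n: "n = Suc k" using assms(3) by (cases n) auto
  obtain \<theta> :: "'a \<Rightarrow> complex" where \<theta>: "additive_character \<theta>"
    using additive_character_exists by blast
  have G: "G \<equiv> unitriangular_group TYPE('a) (Suc (Suc k))" unfolding G_def n by simp
  interpret additive_character \<theta> by (rule \<theta>)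
  interpret heisenberg k G \<theta> by unfold_locales (rule G)
  have "int (card {\<chi> \<in> Heisenberg_characters G. invariant_under G C \<chi>}) =
      invariant_count (int CARD('a) - 1) k"
    unfolding C_def n using invariant_Heisenberg_characters(2) int_card_path_grad_eq_ones[of k, where ?'a = 'a] by simp
  also have "\<dots> = poly (I_tilde_poly (int n)) (int CARD('a) - 1)"
    using poly_I_tilde_poly[of k "int CARD('a) - 1"] by (simp add: n add.commute)
  finally show ?thesis using invariant_Heisenberg_characters(1) unfolding C_def n by simp
qed

end
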